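(* Let $\Gamma$ be a group, and for $j=1,2$ let $\varrho_j\colon\Gamma\to\operatorname{PSL}(2,\mathbb{R})$ be an injective group homomorphism such that $\varrho_j(\Gamma)$ is a lattice. Let $\Delta\subseteq\Gamma$ be a finite-index subgroup and assume $\operatorname{tr}^2\varrho_1(\gamma)=\operatorname{tr}^2\varrho_2(\gamma)$ for all $\gamma\in\Delta$. Then there exists a unique $a\in\operatorname{PGL}(2,\mathbb{R})$ such that $\varrho_2(\gamma)=a\varrho_1(\gamma)a^{-1}$ for all $\gamma\in\Gamma$.
   Context: For $g=\{G,-G\}\in\operatorname{PSL}(2,\mathbb{R})=\operatorname{SL}(2,\mathbb{R})/\{\pm1\}$, $\operatorname{tr}^2g=(\operatorname{tr}G)^2$. $\operatorname{PGL}(2,\mathbb{R})$ acts on its normal subgroup $\operatorname{PSL}(2,\mathbb{R})$ by conjugation. *)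

theory Defs
  imports "HOL-Analysis.Analysis" "HOL-Algebra.Left_Coset"
begin

section \<open>Matrix groups and their projective quotients\<close>

definition SL2R :: "(real^2^2) monoid" where
  "SL2R = \<lparr>carrier = {A. det A = 1}, mult = (**), one = mat 1\<rparr>"

definition GL2R :: "(real^2^2) monoid" where
  "GL2R = \<lparr>carrier = {A. invertible A}, mult = (**), one = mat 1\<rparr>"

definition pm_one :: "(real^2^2) set" where
  "pm_one = {mat 1, - mat 1}"

definition scalar_matrices :: "(real^2^2) set" where
  "scalar_matrices = {c *\<^sub>R mat 1 | c. c \<noteq> 0}"

text \<open>The elements of \<open>PSL2R\<close> are the sets \<open>{G, - G}\<close> with \<open>det G = 1\<close>; those of \<open>PGL2R\<close> are the
  sets of all non-zero multiples of an invertible matrix.\<close>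

definition PSL2R :: "(real^2^2) set monoid" where
  "PSL2R = SL2R Mod pm_one"

definition PGL2R :: "(real^2^2) set monoid" where
  "PGL2R = GL2R Mod scalar_matrices"

text \<open>The inclusion of \<open>PSL2R\<close> into \<open>PGL2R\<close>, sending \<open>{G, - G}\<close> to the class of \<open>G\<close>. Through it
  \<open>PSL2R\<close> is regarded as a normal subgroup of \<open>PGL2R\<close>.\<close>

definition PSL_to_PGL :: "(real^2^2) set \<Rightarrow> (real^2^2) set" where
  "PSL_to_PGL g = scalar_matrices <#>\<^bsub>GL2R\<^esub> g"

text \<open>The squared trace takes the same value on \<open>G\<close> and \<open>- G\<close>, so that the image below is a
  singleton for every \<open>g\<close> in \<open>PSL2R\<close>.\<close>

definition tr2 :: "(real^2^2) set \<Rightarrow> real" where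
  "tr2 g = the_elem ((\<lambda>G. (trace G)\<^sup>2) ` g)"

section \<open>Topologies and lattices\<close>

text \<open>The quotient topology on the image of \<open>topspace X\<close> under \<open>f\<close>.\<close>

definition quotient_topology :: "'a topology \<Rightarrow> ('a \<Rightarrow> 'b) \<Rightarrow> 'b topology" where
  "quotient_topology X f =
     topology (\<lambda>U. U \<subseteq> f ` topspace X \<and> openin X {x \<in> topspace X. f x \<in> U})"

lemma openin_quotient_topology:
  "openin (quotient_topology X f) U \<longleftrightarrow>
     U \<subseteq> f ` topspace X \<and> openin X {x \<in> topspace X. f x \<in> U}"
proof -
  have "istopology (\<lambda>U. U \<subseteq> f ` topspace X \<and> openin X {x \<in> topspace X. f x \<in> U})"
    unfolding istopology_def
  proof (intro conjI allI impI)
    fix S T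
    assume S: "S \<subseteq> f ` topspace X \<and> openin X {x \<in> topspace X. f x \<in> S}"
      and T: "T \<subseteq> f ` topspace X \<and> openin X {x \<in> topspace X. f x \<in> T}"
    show "S \<inter> T \<subseteq> f ` topspace X" using S by blast
    have "{x \<in> topspace X. f x \<in> S \<inter> T} =
        {x \<in> topspace X. f x \<in> S} \<inter> {x \<in> topspace X. f x \<in> T}" by blast
    then show "openin X {x \<in> topspace X. f x \<in> S \<inter> T}" using S T by auto
  next
    fix K
    assume K: "\<forall>S\<in>K. S \<subseteq> f ` topspace X \<and> openin X {x \<in> topspace X. f x \<in> S}"
    then show "\<Union>K \<subseteq> f ` topspace X" by blast
    have "{x \<in> topspace X. f x \<in> \<Union>K} = (\<Union>S\<in>K. {x \<in> topspace X. f x \<in> S})" by blast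
    then show "openin X {x \<in> topspace X. f x \<in> \<Union>K}" using K by auto
  qed
  then show ?thesis
    by (simp add: quotient_topology_def topology_inverse')
qed

definition PSL2R_topology :: "(real^2^2) set topology" where
  "PSL2R_topology = quotient_topology (top_of_set (carrier SL2R)) (\<lambda>A. pm_one #>\<^bsub>SL2R\<^esub> A)"

text \<open>A subgroup \<open>L\<close> of a topological group \<open>G\<close> with topology \<open>T\<close> is a lattice if it is discrete
  and the space \<open>G / L\<close> of left cosets carries a non-zero finite Borel measure that is invariant
  under the left action of \<open>G\<close>.\<close>

definition lattice_in :: "('a, 'b) monoid_scheme \<Rightarrow> 'a topology \<Rightarrow> 'a set \<Rightarrow> bool" where
  "lattice_in G T L \<longleftrightarrow>
     subgroup L G \<and>
     subtopology T L = discrete_topology L \<and>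
     (\<exists>M. space M = lcosets\<^bsub>G\<^esub> L \<and>
          sets M = sigma_sets (lcosets\<^bsub>G\<^esub> L)
                     {U. openin (quotient_topology T (\<lambda>g. g <#\<^bsub>G\<^esub> L)) U} \<and>
          finite_measure M \<and>
          emeasure M (space M) \<noteq> 0 \<and>
          (\<forall>g\<in>carrier G. \<forall>B\<in>sets M. emeasure M ((\<lambda>C. g <#\<^bsub>G\<^esub> C) ` B) = emeasure M B))"

end

theory Submission
  imports Defs
begin

text \<open>A finite invariant measure on \<open>PSL2R / \<Gamma>\<close> gives recurrence: for every one-parameter sequence
  \<open>U n\<close> and every neighbourhood \<open>V\<close> of \<open>1\<close>, some \<open>n \<ge> 1\<close> makes \<open>V\<^sup>-\<^sup>1 U n V\<close> meet \<open>\<Gamma>\<close>, and even any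
  subgroup of finite index. Applied to two hyperbolic one-parameter groups with different axes this
  yields \<open>A\<close>, \<open>B\<close> in the image of \<open>\<Delta>\<close> for which \<open>1, A, B, A B\<close> is a basis of the matrix algebra and
  the traces of \<open>A\<close>, \<open>B\<close>, \<open>A B\<close> do not vanish. Since \<open>trace (A B) + trace (A B\<^sup>-\<^sup>1) = trace A * trace B\<close>,
  equality of squared traces can then be lifted to equality of traces with consistent signs. The
  pair is therefore determined up to conjugation, every other element of \<open>\<Delta>\<close> is determined by its
  traces against the basis, and elements of \<open>\<Gamma>\<close> are determined by their action on
  \<open>\<Delta> \<inter> \<gamma>\<^sup>-\<^sup>1 \<Delta> \<gamma>\<close>, whose centralizer is trivial.\<close>

section \<open>Two-by-two matrices\<close>

text \<open>The adjugate: it inverts matrices of determinant one and, unlike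
  \<open>matrix_inv\<close>, has polynomial entries, so that identities stay within reach of
  \<open>algebra\<close>.\<close>

definition adj2 :: "real^2^2 \<Rightarrow> real^2^2" where
  "adj2 A = vector [vector [A$2$2, - A$1$2], vector [- A$2$1, A$1$1]]"

lemmas mat2_simps = vec_eq_iff forall_2 matrix_matrix_mult_def sum_2 det_2 trace_def mat_def
  adj2_def

lemma adj2_mult: "det A = 1 \<Longrightarrow> adj2 A ** A = mat 1" "det A = 1 \<Longrightarrow> A ** adj2 A = mat 1"
  by (auto simp: mat2_simps algebra_simps)

lemma det_adj2 [simp]: "det (adj2 A) = det A"
  by (simp add: mat2_simps algebra_simps)

lemma trace_mult_adj2: "trace (A ** adj2 B) = trace A * trace B - trace (A ** B)"
  by (simp add: mat2_simps algebra_simps)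

lemma det_uminus_2 [simp]: "det (- A) = det (A :: real^2^2)"
  by (simp add: mat2_simps)

lemma trace_uminus [simp]: "trace (- A) = - trace (A :: real^2^2)"
  by (simp add: mat2_simps)

lemma mult_uminus_mat [simp]:
  fixes A B :: "real^2^2"
  shows "(- A) ** B = - (A ** B)" "A ** (- B) = - (A ** B)"
  by (auto simp: mat2_simps)

text \<open>This is the Fricke trace identity, the left side being \<open>2\<close> minus the trace
  of the group commutator. Since only traces occur on the right, non-degeneracy carries over to any
  pair with the same traces.\<close>

lemma det_commutator:
  fixes A B :: "real^2^2"
  assumes "det A = 1" "det B = 1"
  shows "det (A ** B - B ** A) =
    4 - (trace A)\<^sup>2 - (trace B)\<^sup>2 - (trace (A ** B))\<^sup>2 + trace A * trace B * trace (A ** B)"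
  using assms unfolding mat2_simps vector_minus_component vec_lambda_beta vector_2 by algebra

text \<open>Up to sign, the determinant of the commutator is that of the coordinates of
  \<open>1, A, B, A B\<close>. If it is non-zero, these matrices form a basis, and Cramer's rule
  clears each entry of \<open>X\<close>.\<close>

lemma trace_form_nondegenerate:
  fixes A B X :: "real^2^2"
  assumes "det (A ** B - B ** A) \<noteq> 0"
    and "trace X = 0" "trace (X ** A) = 0" "trace (X ** B) = 0" "trace (X ** (A ** B)) = 0"
  shows "X = 0"
proof -
  have "det (A ** B - B ** A) * X$1$1 = 0" "det (A ** B - B ** A) * X$1$2 = 0"
    "det (A ** B - B ** A) * X$2$1 = 0" "det (A ** B - B ** A) * X$2$2 = 0"
    using assms(2-) unfolding mat2_simps vector_minus_component vec_lambda_beta vector_2 by algebra+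
  then show ?thesis using assms(1) by (simp add: vec_eq_iff forall_2)
qed

text \<open>Together \<open>A\<close> and \<open>B\<close> generate the whole matrix algebra, whose
  centre consists of the scalars.\<close>

lemma centralizer_scalar:
  fixes A B H :: "real^2^2"
  assumes "det (A ** B - B ** A) \<noteq> 0" and "H ** A = A ** H" "H ** B = B ** H"
  shows "H = (H$1$1) *\<^sub>R mat 1"
proof -
  have *: "det (A ** B - B ** A) * H$1$2 = 0" "det (A ** B - B ** A) * H$2$1 = 0"
    "det (A ** B - B ** A) * (H$2$2 - H$1$1) = 0"
    using assms(2-)
    unfolding mat2_simps vector_minus_component vec_lambda_beta vector_2 by algebra+
  have "H$1$2 = 0" "H$2$1 = 0" "H$2$2 = H$1$1" using * assms(1) by auto
  then show ?thesis by (simp add: mat2_simps)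
qed

text \<open>Expanding the last equation and cancelling the squares leaves
  \<open>2 * x * y * (z - z') = 0\<close>. In use, \<open>z\<close> is the trace of a product and
  \<open>x * y - z\<close> that of the product with an inverse.\<close>

lemma square_sign_eq:
  fixes x y z z' :: real
  assumes "x \<noteq> 0" "y \<noteq> 0" "z\<^sup>2 = z'\<^sup>2" "(x * y - z)\<^sup>2 = (x * y - z')\<^sup>2"
  shows "z = z'"
proof -
  have "(x * y) * (z - z') = 0" using assms(3,4) by algebra
  then show ?thesis using assms(1,2) by simp
qed

section \<open>Conjugacy of pairs with equal traces\<close>

lemma trace_conj:
  fixes T S A :: "real^2^2" assumes "S ** T = mat 1" shows "trace (T ** A ** S) = trace A"
  by (metis assms matrix_mul_assoc matrix_mul_lid trace_mul_sym)

text \<open>In the basis \<open>v, B v\<close>, where \<open>v\<close> is an eigenvector of \<open>A\<close>, both matrices are determined by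
  \<open>m\<close> and the traces.\<close>

lemma pair_normal_form:
  fixes A B :: "real^2^2"
  assumes "det A = 1" "det B = 1" and D: "det (A ** B - B ** A) \<noteq> 0" and m: "m \<noteq> 0"
    "trace A = m + 1 / m"
  obtains T :: "real^2^2" where "det T \<noteq> 0"
    "A ** T = T ** vector [vector [m, trace (A ** B) - trace B / m], vector [0, 1 / m]]"
    "B ** T = T ** vector [vector [0, -1], vector [1, trace B]]"
proof -
  \<comment> \<open>\<open>m\<close> is an eigenvalue, being a root of the characteristic
    polynomial; the extra factor \<open>m\<close> clears the denominator in
    \<open>m + 1 / m\<close>.\<close>
  have "det (A - m *\<^sub>R mat 1) = 0"
  proof -
    have "m * det (A - m *\<^sub>R mat 1) = m * (det A - m * trace A + m * m)"
      by (simp add: mat2_simps algebra_simps)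
    also have "\<dots> = 0" using m assms(1) by (simp add: field_simps)
    finally show ?thesis using m by simp
  qed
  then obtain v :: "real^2" where v: "v \<noteq> 0" "(A - m *\<^sub>R mat 1) *v v = 0"
    by (metis invertible_det_nz invertible_left_inverse matrix_left_invertible_ker)
  define w where "w = B *v v"
  define T :: "real^2^2" where "T = vector [vector [v$1, w$1], vector [v$2, w$2]]"
  have e: "A$1$1 * v$1 + A$1$2 * v$2 = m * v$1" "A$2$1 * v$1 + A$2$2 * v$2 = m * v$2"
    using v(2) by (auto simp: mat2_simps matrix_vector_mult_def algebra_simps)
  have w: "w$1 = B$1$1 * v$1 + B$1$2 * v$2" "w$2 = B$2$1 * v$1 + B$2$2 * v$2"
    by (auto simp: w_def matrix_vector_mult_def sum_2)
  show ?thesis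
  proof
    show T: "det T \<noteq> 0"
    proof
      \<comment> \<open>Otherwise \<open>v\<close> would be an eigenvector of both matrices, hence
        in the kernel of their commutator.\<close>
      assume "det T = 0"
      then have "v$1 * w$2 - w$1 * v$2 = 0" by (simp add: T_def det_2)
      then have "det (A ** B - B ** A) * v$1 = 0" "det (A ** B - B ** A) * v$2 = 0"
        using e w unfolding mat2_simps vector_minus_component vec_lambda_beta vector_2 by algebra+
      then have "v = 0" using D by (auto simp: mat2_simps)
      then show False using v by simp
    qed
    \<comment> \<open>By Cayley-Hamilton, \<open>B *v w\<close> equals \<open>trace B\<close> times
      \<open>w\<close> minus \<open>v\<close>.\<close>
    show "B ** T = T ** vector [vector [0, -1], vector [1, trace B]]"
      using assms(2) w unfolding T_def mat2_simps vec_lambda_beta vector_2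
      by (simp add: field_simps)
    \<comment> \<open>Naming the reciprocal turns the claim into polynomial identities modulo
      \<open>k * m = 1\<close>, a form suited to \<open>algebra\<close>.\<close>
    define k where "k = 1 / m"
    have k: "k * m = 1" "A$1$1 + A$2$2 = m + k" using m by (auto simp: k_def mat2_simps)
    have "A ** T = T ** vector [vector [m, trace (A ** B) - trace B * k], vector [0, k]]"
      using assms(1,2) w e k unfolding T_def mat2_simps vec_lambda_beta vector_2
      by (simp; intro conjI; algebra)
    then show "A ** T = T ** vector [vector [m, trace (A ** B) - trace B / m], vector [0, 1 / m]]"
      by (simp add: k_def)
  qed
qed

text \<open>Both pairs share one normal form, which depends only on \<open>m\<close> and the three
  traces, so the two base changes compose to a conjugation. Its determinant may have either sign,
  which is why the conjugating element lives in \<open>PGL2R\<close>.\<close>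

lemma pair_conjugate:
  fixes A B A' B' :: "real^2^2"
  assumes "det A = 1" "det B = 1" "det A' = 1" "det B' = 1"
    and D: "det (A ** B - B ** A) \<noteq> 0" and m: "m \<noteq> 0" "trace A = m + 1 / m"
    and tr: "trace A' = trace A" "trace B' = trace B" "trace (A' ** B') = trace (A ** B)"
  obtains T S where "S ** T = mat 1" "T ** S = mat 1" "A' = T ** A ** S" "B' = T ** B ** S"
proof -
  have D': "det (A' ** B' - B' ** A') \<noteq> 0"
    using D by (simp add: det_commutator assms)
  obtain P where P: "det P \<noteq> 0"
    "A ** P = P ** vector [vector [m, trace (A ** B) - trace B / m], vector [0, 1 / m]]"
    "B ** P = P ** vector [vector [0, -1], vector [1, trace B]]"
    using pair_normal_form[OF assms(1,2) D m] by blast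
  obtain Q where Q: "det Q \<noteq> 0"
    "A' ** Q = Q ** vector [vector [m, trace (A ** B) - trace B / m], vector [0, 1 / m]]"
    "B' ** Q = Q ** vector [vector [0, -1], vector [1, trace B]]"
    using pair_normal_form[OF assms(3,4) D' m(1)] m(2) tr by metis
  obtain P' where P': "P ** P' = mat 1" "P' ** P = mat 1"
    using P(1) by (metis invertible_det_nz invertible_def)
  obtain Q' where Q': "Q ** Q' = mat 1" "Q' ** Q = mat 1"
    using Q(1) by (metis invertible_det_nz invertible_def)
  have conj: "Y = (Q ** P') ** X ** (P ** Q')" if "X ** P = P ** N" "Y ** Q = Q ** N" for X Y N
  proof -
    have "(Q ** P') ** X ** (P ** Q') = Q ** (P' ** (X ** P)) ** Q'" by (simp add: matrix_mul_assoc)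
    also have "\<dots> = Q ** ((P' ** P) ** N) ** Q'" by (simp only: that matrix_mul_assoc)
    also have "\<dots> = (Y ** Q) ** Q'" by (simp only: P' that matrix_mul_lid)
    also have "\<dots> = Y" by (simp only: matrix_mul_assoc[symmetric] Q' matrix_mul_rid)
    finally show ?thesis by simp
  qed
  show ?thesis
  proof
    show "(P ** Q') ** (Q ** P') = mat 1" "(Q ** P') ** (P ** Q') = mat 1"
      by (metis P' Q' matrix_mul_assoc matrix_mul_lid)+
    show "A' = (Q ** P') ** A ** (P ** Q')" "B' = (Q ** P') ** B ** (P ** Q')"
      using conj P Q by blast+
  qed
qed

section \<open>The projective groups\<close>

definition psl :: "real^2^2 \<Rightarrow> (real^2^2) set" where
  "psl A = {A, - A}"

definition pgl :: "real^2^2 \<Rightarrow> (real^2^2) set" where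
  "pgl A = {c *\<^sub>R A | c. c \<noteq> 0}"

lemma SL2R_simps [simp]:
  "carrier SL2R = {A. det A = 1}" "A \<otimes>\<^bsub>SL2R\<^esub> B = A ** B" "\<one>\<^bsub>SL2R\<^esub> = mat 1"
  by (simp_all add: SL2R_def)

lemma GL2R_simps [simp]:
  "carrier GL2R = {A. invertible A}" "A \<otimes>\<^bsub>GL2R\<^esub> B = A ** B" "\<one>\<^bsub>GL2R\<^esub> = mat 1"
  by (simp_all add: GL2R_def)

lemma group_SL2R: "group SL2R"
  by (rule groupI) (auto simp: det_mul matrix_mul_assoc intro: exI[of _ "adj2 _"] adj2_mult)

lemma group_GL2R: "group GL2R"
proof (rule groupI)
  fix A assume "A \<in> carrier GL2R"
  then show "\<exists>B\<in>carrier GL2R. B \<otimes>\<^bsub>GL2R\<^esub> A = \<one>\<^bsub>GL2R\<^esub>"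
    by (auto simp: invertible_def)
qed (auto simp: invertible_mult matrix_mul_assoc invertible_def[of "mat 1"])

lemma psl_eq_iff: "psl A = psl B \<longleftrightarrow> A = B \<or> A = - B"
  by (auto simp: psl_def doubleton_eq_iff)

lemma r_coset_pm_one [simp]: "pm_one #>\<^bsub>SL2R\<^esub> A = psl A"
  by (auto simp: r_coset_def pm_one_def psl_def)

lemma r_coset_scalar [simp]: "scalar_matrices #>\<^bsub>GL2R\<^esub> A = pgl A"
  by (auto simp: r_coset_def scalar_matrices_def pgl_def scaleR_matrix_vector_assoc matrix_scalar_ac
      simp flip: scalar_matrix_assoc)

lemma pm_one_normal: "pm_one \<lhd> SL2R"
proof (rule group.normalI[OF group_SL2R])
  interpret group SL2R by (rule group_SL2R)
  have inv: "inv\<^bsub>SL2R\<^esub> (- mat 1) = - mat 1" "inv\<^bsub>SL2R\<^esub> (mat 1) = mat 1"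
    by (rule inv_equality; simp)+
  show "subgroup pm_one SL2R"
    using inv by (intro subgroupI) (auto simp: pm_one_def)
qed (unfold r_coset_pm_one, auto simp: l_coset_def pm_one_def psl_def)

lemma scalar_mult [simp]:
  fixes A B :: "real^2^2"
  shows "(c *\<^sub>R A) ** B = c *\<^sub>R (A ** B)" "A ** (c *\<^sub>R B) = c *\<^sub>R (A ** B)"
  by (auto simp: mat2_simps algebra_simps)

lemma scalar_normal: "scalar_matrices \<lhd> GL2R"
proof (rule group.normalI[OF group_GL2R])
  interpret group GL2R by (rule group_GL2R)
  have [simp]: "invertible (c *\<^sub>R mat 1 :: real^2^2)" if "c \<noteq> 0" for c
    using that unfolding invertible_def by (intro exI[of _ "inverse c *\<^sub>R mat 1"]) auto
  have inv: "inv\<^bsub>GL2R\<^esub> (c *\<^sub>R mat 1) = inverse c *\<^sub>R mat 1" if "c \<noteq> 0" for c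
    using that by (intro inv_equality) auto
  show "subgroup scalar_matrices GL2R"
  proof (rule subgroupI)
    show "scalar_matrices \<subseteq> carrier GL2R" by (auto simp: scalar_matrices_def)
    have "1 *\<^sub>R mat 1 \<in> scalar_matrices"
      unfolding scalar_matrices_def by (auto intro: exI[of _ "1::real"])
    then show "scalar_matrices \<noteq> {}" by blast
    show "inv\<^bsub>GL2R\<^esub> A \<in> scalar_matrices" if A: "A \<in> scalar_matrices" for A
    proof -
      obtain c where c: "c \<noteq> 0" "A = c *\<^sub>R mat 1" using A by (auto simp: scalar_matrices_def)
      then have "inv\<^bsub>GL2R\<^esub> A = inverse c *\<^sub>R mat 1" using inv by simp
      moreover have "inverse c \<noteq> 0" using c by simp
      ultimately show ?thesis unfolding scalar_matrices_def by blast
    qed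
    show "A \<otimes>\<^bsub>GL2R\<^esub> B \<in> scalar_matrices" if AB: "A \<in> scalar_matrices" "B \<in> scalar_matrices" for A B
    proof -
      obtain c d where c: "c \<noteq> 0" "A = c *\<^sub>R mat 1" "d \<noteq> 0" "B = d *\<^sub>R mat 1"
        using AB by (auto simp: scalar_matrices_def)
      then have "A \<otimes>\<^bsub>GL2R\<^esub> B = (c * d) *\<^sub>R mat 1" "c * d \<noteq> 0" by simp_all
      then show ?thesis unfolding scalar_matrices_def by blast
    qed
  qed
qed (unfold r_coset_def l_coset_def, intro ballI SUP_cong refl, auto simp: scalar_matrices_def)

lemma group_PSL2R: "group PSL2R"
  unfolding PSL2R_def by (rule normal.factorgroup_is_group[OF pm_one_normal])

lemma group_PGL2R: "group PGL2R"
  unfolding PGL2R_def by (rule normal.factorgroup_is_group[OF scalar_normal])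

lemma carrier_PSL2R: "carrier PSL2R = psl ` {A. det A = 1}"
  by (auto simp: PSL2R_def carrier_FactGroup)

lemma carrier_PGL2R: "carrier PGL2R = pgl ` {A. invertible A}"
  by (auto simp: PGL2R_def carrier_FactGroup)

lemma psl_mult [simp]: "psl A \<otimes>\<^bsub>PSL2R\<^esub> psl B = psl (A ** B)"
  by (auto simp: PSL2R_def set_mult_def psl_def)

lemma pgl_mult [simp]: "pgl A \<otimes>\<^bsub>PGL2R\<^esub> pgl B = pgl (A ** B)"
proof -
  have "c *\<^sub>R (A ** B) \<in> (\<Union>h\<in>pgl A. \<Union>k\<in>pgl B. {h ** k})" if "c \<noteq> 0" for c
  proof -
    have "c *\<^sub>R A \<in> pgl A" "B \<in> pgl B"
      using that unfolding pgl_def by (auto intro: exI[of _ "1::real"])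
    then show ?thesis by force
  qed
  then show ?thesis
    by (auto simp: PGL2R_def set_mult_def) (auto simp: pgl_def)
qed

lemma one_PSL2R: "\<one>\<^bsub>PSL2R\<^esub> = psl (mat 1)"
  by (simp add: PSL2R_def psl_def pm_one_def)

lemma one_PGL2R: "\<one>\<^bsub>PGL2R\<^esub> = pgl (mat 1)"
  by (simp add: PGL2R_def pgl_def scalar_matrices_def)

lemma psl_inv: "det A = 1 \<Longrightarrow> inv\<^bsub>PSL2R\<^esub> (psl A) = psl (adj2 A)"
  by (rule group.inv_equality[OF group_PSL2R])
    (auto simp: carrier_PSL2R adj2_mult one_PSL2R)

lemma pgl_inv:
  assumes "A ** B = mat 1" "B ** A = mat 1"
  shows "inv\<^bsub>PGL2R\<^esub> (pgl A) = pgl B"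
  by (rule group.inv_equality[OF group_PGL2R])
    (use assms in \<open>auto simp: carrier_PGL2R invertible_def one_PGL2R\<close>)

lemma PSL_to_PGL_psl [simp]: "PSL_to_PGL (psl A) = pgl A"
proof -
  have "c *\<^sub>R A = (c *\<^sub>R mat 1) ** A" "- (c *\<^sub>R A) = ((- c) *\<^sub>R mat 1) ** A" for c by auto
  then show ?thesis
    unfolding PSL_to_PGL_def set_mult_def psl_def pgl_def scalar_matrices_def
    by (auto) (metis neg_equal_0_iff_equal scaleR_minus_left)
qed

lemma tr2_psl [simp]: "tr2 (psl A) = (trace A)\<^sup>2"
  by (simp add: tr2_def psl_def)

lemma pgl_eqD: 
  assumes "pgl A = pgl B" obtains c where "c \<noteq> 0" "A = c *\<^sub>R B"
proof -
  have "A \<in> pgl A" unfolding pgl_def by (auto intro: exI[of _ "1::real"])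
  then show ?thesis using assms that by (auto simp: pgl_def)
qed

lemma pgl_scale:
  assumes "c \<noteq> 0" shows "pgl (c *\<^sub>R A) = pgl A"
proof (intro Set.set_eqI iffI)
  fix X assume "X \<in> pgl (c *\<^sub>R A)"
  then obtain d where "d \<noteq> 0" "X = (d * c) *\<^sub>R A" by (auto simp: pgl_def)
  then show "X \<in> pgl A" unfolding pgl_def using assms by (intro CollectI exI[of _ "d * c"]) auto
next
  fix X assume "X \<in> pgl A"
  then obtain d where "d \<noteq> 0" "X = d *\<^sub>R A" by (auto simp: pgl_def)
  then show "X \<in> pgl (c *\<^sub>R A)"
    unfolding pgl_def using assms by (intro CollectI exI[of _ "d / c"]) auto
qed

section \<open>Recurrence in the coset space of a lattice\<close>

abbreviation SL2 :: "(real^2^2) set" where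
  "SL2 \<equiv> {A. det A = 1}"

lemma adj2_adj2 [simp]: "adj2 (adj2 A) = A"
  by (simp add: mat2_simps)

lemma adj2_matrix_mult: "adj2 (A ** B) = adj2 B ** adj2 A"
  by (simp add: mat2_simps algebra_simps)

lemma continuous_on_matrix_mult2 [continuous_intros]:
  fixes f g :: "'a::topological_space \<Rightarrow> real^2^2"
  assumes "continuous_on S f" "continuous_on S g"
  shows "continuous_on S (\<lambda>x. f x ** g x)"
  unfolding matrix_matrix_mult_def using assms by (auto intro!: continuous_intros)

lemma topspace_quotient_topology: "topspace (quotient_topology X f) = f ` topspace X"
proof
  show "topspace (quotient_topology X f) \<subseteq> f ` topspace X"
    unfolding topspace_def openin_quotient_topology by blast
  have "{x \<in> topspace X. f x \<in> f ` topspace X} = topspace X" by blast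
  then have "openin (quotient_topology X f) (f ` topspace X)"
    unfolding openin_quotient_topology by simp
  then show "f ` topspace X \<subseteq> topspace (quotient_topology X f)"
    by (rule openin_subset)
qed

lemma topspace_PSL2R_topology: "topspace PSL2R_topology = psl ` SL2"
  by (simp add: PSL2R_topology_def topspace_quotient_topology)

text \<open>Cosets are indexed by matrices so that openness can be studied in \<open>SL2\<close>,
  where multiplication is visibly continuous.\<close>

definition orbit_pt :: "(real^2^2) set set \<Rightarrow> real^2^2 \<Rightarrow> (real^2^2) set set" where
  "orbit_pt L A = psl A <#\<^bsub>PSL2R\<^esub> L"

text \<open>Two successive quotient maps compose to one, so openness can be tested directly on
  matrices.\<close>

lemma openin_coset_space:
  "openin (quotient_topology PSL2R_topology (\<lambda>g. g <#\<^bsub>PSL2R\<^esub> L)) W \<longleftrightarrow>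
     W \<subseteq> orbit_pt L ` SL2 \<and> openin (top_of_set SL2) {A \<in> SL2. orbit_pt L A \<in> W}"
proof -
  have "{A \<in> SL2. psl A \<in> {g \<in> psl ` SL2. g <#\<^bsub>PSL2R\<^esub> L \<in> W}} = {A \<in> SL2. orbit_pt L A \<in> W}"
    by (auto simp: orbit_pt_def)
  then show ?thesis
    unfolding openin_quotient_topology topspace_PSL2R_topology
    by (simp add: PSL2R_topology_def openin_quotient_topology image_image orbit_pt_def)
qed

lemma orbit_pt_eq_iff:
  assumes L: "subgroup L PSL2R" and "A \<in> SL2" "B \<in> SL2"
  shows "orbit_pt L A = orbit_pt L B \<longleftrightarrow> psl (adj2 A ** B) \<in> L"
proof -
  interpret group PSL2R by (rule group_PSL2R)
  interpret L: subgroup L PSL2R by (rule L)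
  have mem: "psl A \<in> carrier PSL2R" "psl B \<in> carrier PSL2R" using assms by (auto simp: carrier_PSL2R)
  have *: "psl (adj2 A ** B) = inv\<^bsub>PSL2R\<^esub> (psl A) \<otimes>\<^bsub>PSL2R\<^esub> psl B"
    using assms by (simp add: psl_inv)
  show ?thesis
  proof
    assume "orbit_pt L A = orbit_pt L B"
    then have "psl B \<in> psl A <#\<^bsub>PSL2R\<^esub> L"
      using lcos_self[OF mem(2) L] by (simp add: orbit_pt_def)
    then show "psl (adj2 A ** B) \<in> L"
      using * L.lcos_module_imp[OF group_PSL2R mem(1)] by simp
  next
    assume "psl (adj2 A ** B) \<in> L"
    then have "psl B \<in> psl A <#\<^bsub>PSL2R\<^esub> L"
      using * L.lcos_module_rev[OF group_PSL2R mem] by simp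
    then show "orbit_pt L A = orbit_pt L B"
      using l_repr_independence[OF _ mem(1) L] by (simp add: orbit_pt_def)
  qed
qed

text \<open>The preimage of the image is the union of the right translates of \<open>V\<close> by
  representatives of \<open>L\<close>, each of them open.\<close>

lemma openin_orbit_pt_image:
  assumes L: "subgroup L PSL2R" and V: "openin (top_of_set SL2) V"
  shows "openin (quotient_topology PSL2R_topology (\<lambda>g. g <#\<^bsub>PSL2R\<^esub> L)) (orbit_pt L ` V)"
proof -
  have sub: "V \<subseteq> SL2" using V openin_imp_subset by blast
  have eq: "{A \<in> SL2. orbit_pt L A \<in> orbit_pt L ` V} =
      (\<Union>C \<in> {C \<in> SL2. psl C \<in> L}. SL2 \<inter> (\<lambda>A. A ** C) -` V)"
  proof (intro subset_antisym subsetI)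
    fix A assume "A \<in> {A \<in> SL2. orbit_pt L A \<in> orbit_pt L ` V}"
    then obtain B where A: "A \<in> SL2" and B: "B \<in> V" "orbit_pt L A = orbit_pt L B" by blast
    then have "psl (adj2 A ** B) \<in> L" using orbit_pt_eq_iff[OF L A] sub by blast
    moreover have "A ** (adj2 A ** B) = B"
      using A by (simp add: matrix_mul_assoc adj2_mult)
    moreover have "adj2 A ** B \<in> SL2" using A B sub by (auto simp: det_mul)
    ultimately show "A \<in> (\<Union>C \<in> {C \<in> SL2. psl C \<in> L}. SL2 \<inter> (\<lambda>A. A ** C) -` V)"
      using A B by (intro UN_I[of "adj2 A ** B"]) auto
  next
    fix A assume "A \<in> (\<Union>C \<in> {C \<in> SL2. psl C \<in> L}. SL2 \<inter> (\<lambda>A. A ** C) -` V)"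
    then obtain C where C: "C \<in> SL2" "psl C \<in> L" "A \<in> SL2" "A ** C \<in> V" by blast
    have "adj2 A ** (A ** C) = C" using C by (simp add: matrix_mul_assoc adj2_mult)
    then have "orbit_pt L A = orbit_pt L (A ** C)"
      using C sub by (subst orbit_pt_eq_iff[OF L]) auto
    then show "A \<in> {A \<in> SL2. orbit_pt L A \<in> orbit_pt L ` V}" using C by blast
  qed
  have "openin (top_of_set SL2) (SL2 \<inter> (\<lambda>A. A ** C) -` V)" if "C \<in> SL2" for C
    using that V by (intro continuous_openin_preimage[where T = SL2])
      (auto intro!: continuous_intros simp: det_mul)
  then have "openin (top_of_set SL2) {A \<in> SL2. orbit_pt L A \<in> orbit_pt L ` V}"
    unfolding eq by (intro openin_Union) blast
  then show ?thesis using sub unfolding openin_coset_space by blast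
qed

lemma openin_translate:
  assumes "openin (top_of_set SL2) V" "A \<in> SL2"
  shows "openin (top_of_set SL2) ((\<lambda>B. A ** B) ` V)"
proof -
  have sub: "V \<subseteq> SL2" using assms openin_imp_subset by blast
  have "(\<lambda>B. A ** B) ` V = SL2 \<inter> (\<lambda>B. adj2 A ** B) -` V"
  proof (intro subset_antisym subsetI)
    fix B assume "B \<in> SL2 \<inter> (\<lambda>B. adj2 A ** B) -` V"
    moreover have "B = A ** (adj2 A ** B)" using assms by (simp add: matrix_mul_assoc adj2_mult)
    ultimately show "B \<in> (\<lambda>B. A ** B) ` V" by blast
  qed (use assms sub in \<open>auto simp: det_mul matrix_mul_assoc adj2_mult\<close>)
  moreover have "openin (top_of_set SL2) (SL2 \<inter> (\<lambda>B. adj2 A ** B) -` V)"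
    using assms by (intro continuous_openin_preimage[where T = SL2])
      (auto intro!: continuous_intros simp: det_mul)
  ultimately show ?thesis by simp
qed

lemma orbit_pt_translate:
  assumes "subgroup L PSL2R" "A \<in> SL2" "V \<subseteq> SL2"
  shows "(\<lambda>C. psl A <#\<^bsub>PSL2R\<^esub> C) ` orbit_pt L ` V = orbit_pt L ` (\<lambda>B. A ** B) ` V"
proof -
  interpret group PSL2R by (rule group_PSL2R)
  have "psl A <#\<^bsub>PSL2R\<^esub> orbit_pt L B = orbit_pt L (A ** B)" if "B \<in> V" for B
    unfolding orbit_pt_def using assms that subgroup.subset[OF assms(1)]
    by (subst lcos_m_assoc) (auto simp: carrier_PSL2R)
  then show ?thesis by (simp add: image_image)
qed

text \<open>Pigeonhole principle for measures: if no point lay in more than \<open>k\<close> of the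
  sets, integrating the sum of their indicators would bound \<open>K * e\<close> by \<open>k\<close>
  times the total mass.\<close>

lemma (in finite_measure) exists_point_multiplicity:
  fixes k K :: nat
  assumes W: "\<And>i. i < K \<Longrightarrow> W i \<in> sets M" "\<And>i. i < K \<Longrightarrow> measure M (W i) = e"
    and K: "real k * measure M (space M) < real K * e"
  shows "\<exists>x\<in>space M. k < card {i. i < K \<and> x \<in> W i}"
proof (rule ccontr)
  assume *: "\<not> ?thesis"
  have int: "integrable M (indicat_real (W i))" if "i < K" for i
    using W(1)[OF that] by (simp add: less_top[symmetric])
  have "real K * e = (\<Sum>i<K. measure M (W i))" using W by simp
  also have "\<dots> = (\<Sum>i<K. \<integral>x. indicat_real (W i) x \<partial>M)"
    using W by (intro sum.cong) (auto simp: Int_absorb2 sets.sets_into_space)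
  also have "\<dots> = (\<integral>x. (\<Sum>i<K. indicat_real (W i) x) \<partial>M)"
    using int by (intro Bochner_Integration.integral_sum[symmetric]) auto
  also have "\<dots> \<le> (\<integral>x. real k \<partial>M)"
  proof (rule integral_mono)
    fix x assume "x \<in> space M"
    then have "card {i. i < K \<and> x \<in> W i} \<le> k" using * by force
    moreover have "(\<Sum>i<K. indicat_real (W i) x) = card {i. i < K \<and> x \<in> W i}"
      by (simp add: indicator_def sum.If_cases Int_def)
    ultimately show "(\<Sum>i<K. indicat_real (W i) x) \<le> real k" by simp
  qed (use int in auto)
  also have "\<dots> = real k * measure M (space M)" by simp
  finally show False using K by simp
qed

text \<open>The translates of a non-empty open set all have the same positive measure, while the
  total mass is finite. Enough of them must therefore overlap.\<close>

lemma lattice_multiplicity: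
  assumes lat: "lattice_in PSL2R PSL2R_topology L"
    and V: "openin (top_of_set SL2) V" "V \<noteq> {}" and U: "\<And>i. U i \<in> SL2"
  obtains K h where "h \<in> SL2"
    "k < card {i. i < (K::nat) \<and> orbit_pt L h \<in> orbit_pt L ` (\<lambda>A. U i ** A) ` V}"
proof -
  obtain M where L: "subgroup L PSL2R" and
    M: "space M = lcosets\<^bsub>PSL2R\<^esub> L" "finite_measure M" "emeasure M (space M) \<noteq> 0"
    and sets: "sets M = sigma_sets (lcosets\<^bsub>PSL2R\<^esub> L)
        {W. openin (quotient_topology PSL2R_topology (\<lambda>g. g <#\<^bsub>PSL2R\<^esub> L)) W}"
    and inv: "\<And>g B. g \<in> carrier PSL2R \<Longrightarrow> B \<in> sets M \<Longrightarrow>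
        emeasure M ((\<lambda>C. g <#\<^bsub>PSL2R\<^esub> C) ` B) = emeasure M B"
    using lat unfolding lattice_in_def by blast
  interpret finite_measure M by (rule M)
  have sub: "V \<subseteq> SL2" using V openin_imp_subset by blast
  have space: "space M = orbit_pt L ` SL2"
    unfolding M LCOSETS_def carrier_PSL2R orbit_pt_def by auto
  have meas: "orbit_pt L ` W \<in> sets M" if "openin (top_of_set SL2) W" for W
    unfolding sets using openin_orbit_pt_image[OF L that] by blast
  have shift: "emeasure M (orbit_pt L ` (\<lambda>B. A ** B) ` V) = emeasure M (orbit_pt L ` V)"
    if "A \<in> SL2" for A
    using inv[OF _ meas[OF V(1)], of "psl A"] that orbit_pt_translate[OF L that sub]
    by (auto simp: carrier_PSL2R)
  have pos: "emeasure M (orbit_pt L ` V) \<noteq> 0"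
  proof
    assume null: "emeasure M (orbit_pt L ` V) = 0"
    \<comment> \<open>All translates of \<open>V\<close> are null as well. By the Lindelof property
      countably many of them cover the group, so the whole space would be null.\<close>
    define \<F> where "\<F> = (\<lambda>A. (\<lambda>B. A ** B) ` V) ` SL2"
    obtain v where v: "v \<in> V" using V by blast
    have "\<Union>\<F> = SL2"
    proof
      show "\<Union>\<F> \<subseteq> SL2" using sub by (auto simp: \<F>_def det_mul)
      show "SL2 \<subseteq> \<Union>\<F>"
      proof
        fix A assume A: "A \<in> SL2"
        have "A = (A ** adj2 v) ** v" "A ** adj2 v \<in> SL2"
          using A v sub by (auto simp: det_mul adj2_mult simp flip: matrix_mul_assoc)
        then show "A \<in> \<Union>\<F>" using v unfolding \<F>_def by blast
      qed
    qed
    moreover have "\<And>S. S \<in> \<F> \<Longrightarrow> openin (top_of_set SL2) S"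
      unfolding \<F>_def using openin_translate[OF V(1)] by blast
    ultimately obtain \<G> where \<G>: "\<G> \<subseteq> \<F>" "countable \<G>" "\<Union>\<G> = SL2"
      using Lindelof_openin[of \<F> SL2] by metis
    have "(\<Union>S\<in>\<G>. orbit_pt L ` S) \<in> null_sets M"
    proof (rule null_sets_UN')
      fix S assume "S \<in> \<G>"
      then obtain A where A: "A \<in> SL2" "S = (\<lambda>B. A ** B) ` V" using \<G> unfolding \<F>_def by blast
      then show "orbit_pt L ` S \<in> null_sets M"
        using shift[OF A(1)] null meas[OF openin_translate[OF V(1) A(1)]] by (auto intro: null_setsI)
    qed (rule \<G>)
    moreover have "(\<Union>S\<in>\<G>. orbit_pt L ` S) = space M" unfolding space using \<G> by blast
    ultimately show False using M(3) by (simp add: null_sets_def)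
  qed
  define e where "e = measure M (orbit_pt L ` V)"
  have e: "e > 0" using pos unfolding e_def by (simp add: emeasure_eq_measure measure_nonneg less_le)
  obtain K :: nat where "real k * measure M (space M) / e < real K" using reals_Archimedean2 by blast
  then have K: "real k * measure M (space M) < real K * e" using e by (simp add: field_simps)
  have "\<exists>x\<in>space M. k < card {i. i < K \<and> x \<in> orbit_pt L ` (\<lambda>A. U i ** A) ` V}"
    by (rule exists_point_multiplicity[OF _ _ K])
      (use U shift meas openin_translate[OF V(1)] in \<open>auto simp: e_def measure_def\<close>)
  then show ?thesis using that unfolding space by blast
qed

text \<open>The labels \<open>\<kappa>\<close> make this applicable to subgroups of finite index without transferring the
  measure to their coset spaces.\<close>

lemma lattice_recurrence:
  fixes \<Gamma> :: "('a, 'b) monoid_scheme" and U :: "nat \<Rightarrow> real^2^2"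
  assumes \<Gamma>: "group \<Gamma>" and \<rho>: "\<rho> \<in> hom \<Gamma> PSL2R"
    and lat: "lattice_in PSL2R PSL2R_topology (\<rho> ` carrier \<Gamma>)"
    and fin: "finite (\<kappa> ` carrier \<Gamma>)"
    and V: "openin (top_of_set SL2) V" "V \<noteq> {}" and U: "\<And>i. U i \<in> SL2"
    and add: "\<And>i j. U (i + j) = U i ** U j"
  obtains n w w' g g' where "n \<ge> 1" "w \<in> V" "w' \<in> V" "g \<in> carrier \<Gamma>" "g' \<in> carrier \<Gamma>"
    "\<kappa> g = \<kappa> g'" "\<rho> (inv\<^bsub>\<Gamma>\<^esub> g \<otimes>\<^bsub>\<Gamma>\<^esub> g') = psl (adj2 w ** U n ** w')"
proof -
  interpret \<Gamma>: group \<Gamma> by (rule \<Gamma>)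
  interpret \<rho>: group_hom \<Gamma> PSL2R \<rho>
    using \<Gamma> group_PSL2R \<rho> by (simp add: group_hom_def group_hom_axioms_def)
  define L where "L = \<rho> ` carrier \<Gamma>"
  have L: "subgroup L PSL2R" and lat: "lattice_in PSL2R PSL2R_topology L"
    using lat by (auto simp: L_def lattice_in_def)
  have sub: "V \<subseteq> SL2" using V openin_imp_subset by blast
  \<comment> \<open>With more overlapping translates than labels, two of the indices must carry the
    same label.\<close>
  obtain K h where h: "h \<in> SL2" and
    card: "card (\<kappa> ` carrier \<Gamma>) < card {i. i < (K::nat) \<and> orbit_pt L h \<in> orbit_pt L ` (\<lambda>A. U i ** A) ` V}"
    by (rule lattice_multiplicity[OF lat V U, where k = "card (\<kappa> ` carrier \<Gamma>)"])
  define I where "I = {i. i < K \<and> orbit_pt L h \<in> orbit_pt L ` (\<lambda>A. U i ** A) ` V}"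
  have "\<exists>w g. w \<in> V \<and> g \<in> carrier \<Gamma> \<and> \<rho> g = psl (adj2 h ** (U i ** w))" if i: "i \<in> I" for i
  proof -
    obtain w where w: "w \<in> V" "orbit_pt L h = orbit_pt L (U i ** w)"
      using i by (auto simp: I_def)
    have "U i ** w \<in> SL2" using U[of i] w sub by (auto simp: det_mul)
    then have "psl (adj2 h ** (U i ** w)) \<in> L" using w orbit_pt_eq_iff[OF L h] by blast
    then show ?thesis using w unfolding L_def by (metis imageE)
  qed
  then obtain w g where wg: "\<And>i. i \<in> I \<Longrightarrow> w i \<in> V" "\<And>i. i \<in> I \<Longrightarrow> g i \<in> carrier \<Gamma>"
    "\<And>i. i \<in> I \<Longrightarrow> \<rho> (g i) = psl (adj2 h ** (U i ** w i))"
    by metis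
  have "\<not> inj_on (\<lambda>i. \<kappa> (g i)) I"
    using card fin card_inj_on_le[of "\<lambda>i. \<kappa> (g i)" I "\<kappa> ` carrier \<Gamma>"] wg(2)
    unfolding I_def[symmetric] by (auto simp: not_le)
  then obtain i j where "i \<in> I" "j \<in> I" "\<kappa> (g i) = \<kappa> (g j)" "i \<noteq> j"
    unfolding inj_on_def by blast
  then obtain i j where ij: "i \<in> I" "j \<in> I" "\<kappa> (g i) = \<kappa> (g j)" "i < j"
    by (metis linorder_neqE_nat)
  have det: "det (adj2 h ** (U i ** w i)) = 1"
    using h U[of i] wg(1)[OF ij(1)] sub by (auto simp: det_mul)
  have "\<rho> (inv\<^bsub>\<Gamma>\<^esub> (g i) \<otimes>\<^bsub>\<Gamma>\<^esub> g j) =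
      psl (adj2 (adj2 h ** (U i ** w i)) ** (adj2 h ** (U j ** w j)))"
    using wg(2,3)[OF ij(1)] wg(2,3)[OF ij(2)] psl_inv[OF det] by simp
  also have "adj2 (adj2 h ** (U i ** w i)) ** (adj2 h ** (U j ** w j)) =
      adj2 (w i) ** (adj2 (U i) ** (h ** adj2 h) ** U j) ** w j"
    by (simp add: adj2_matrix_mult matrix_mul_assoc)
  also have "adj2 (U i) ** (h ** adj2 h) ** U j = U (j - i)"
    \<comment> \<open>Here \<open>U j = U i ** U (j - i)\<close> since \<open>i < j\<close>. The
      base point \<open>h\<close> cancels, and \<open>j - i\<close> is the required positive
      exponent.\<close>
    using add[of i "j - i"] U[of i] h ij by (simp add: adj2_mult matrix_mul_assoc)
  finally show ?thesis
    using that[of "j - i" "w i" "w j" "g i" "g j"] ij wg by simp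
qed

section \<open>Non-degenerate pairs\<close>

text \<open>The constants \<open>100\<close> and \<open>1/1000\<close> below only have to be large and small enough for the limiting
  traces \<open>1\<close>, \<open>1\<close> and \<open>1/2\<close> of the rescaled \<open>A\<close>, \<open>B\<close> and \<open>A B\<close> to dominate the errors.\<close>

definition diag_mat :: "real \<Rightarrow> real \<Rightarrow> real^2^2" where
  "diag_mat t r = vector [vector [t, 0], vector [0, r]]"

text \<open>This is \<open>diag_mat t r\<close> turned by an angle of pi/4: \<open>(1, 1)\<close>
  and \<open>(1, -1)\<close> are eigenvectors for \<open>t\<close> and \<open>r\<close>. Its
  eigenlines thus differ from the coordinate axes.\<close>

definition sym_mat :: "real \<Rightarrow> real \<Rightarrow> real^2^2" where
  "sym_mat t r = vector [vector [(t + r) / 2, (t - r) / 2], vector [(t - r) / 2, (t + r) / 2]]"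

definition hyp_diag :: "nat \<Rightarrow> real^2^2" where
  "hyp_diag n = diag_mat (100 ^ n) ((1 / 100) ^ n)"

definition hyp_sym :: "nat \<Rightarrow> real^2^2" where
  "hyp_sym n = sym_mat (100 ^ n) ((1 / 100) ^ n)"

definition near_one :: "(real^2^2) set" where
  "near_one = {w \<in> SL2. \<bar>w$1$1 - 1\<bar> < 1/1000 \<and> \<bar>w$1$2\<bar> < 1/1000 \<and> \<bar>w$2$1\<bar> < 1/1000 \<and>
                        \<bar>w$2$2 - 1\<bar> < 1/1000}"

definition entries_close :: "real \<Rightarrow> real^2^2 \<Rightarrow> real^2^2 \<Rightarrow> bool" where
  "entries_close e A B \<longleftrightarrow> (\<forall>i j. \<bar>A$i$j - B$i$j\<bar> \<le> e)"

lemma diag_mat_mult: "diag_mat t r ** diag_mat t' r' = diag_mat (t * t') (r * r')"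
  by (simp add: diag_mat_def mat2_simps)

lemma sym_mat_mult: "sym_mat t r ** sym_mat t' r' = sym_mat (t * t') (r * r')"
  by (simp add: sym_mat_def mat2_simps field_simps)

lemma det_diag_mat: "det (diag_mat t r) = t * r"
  by (simp add: diag_mat_def det_2)

lemma det_sym_mat: "det (sym_mat t r) = t * r"
  by (simp add: sym_mat_def det_2 field_simps)

lemma hyp_diag_SL2: "hyp_diag n \<in> SL2" and hyp_sym_SL2: "hyp_sym n \<in> SL2"
  by (simp_all add: hyp_diag_def hyp_sym_def det_diag_mat det_sym_mat flip: power_mult_distrib)

lemma hyp_diag_add: "hyp_diag (m + n) = hyp_diag m ** hyp_diag n"
  and hyp_sym_add: "hyp_sym (m + n) = hyp_sym m ** hyp_sym n"
  by (simp_all add: hyp_diag_def hyp_sym_def diag_mat_mult sym_mat_mult power_add)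

lemma near_one_open: "openin (top_of_set SL2) near_one"
proof -
  define T where "T = {w::real^2^2. \<bar>w$1$1 - 1\<bar> < 1/1000 \<and> \<bar>w$1$2\<bar> < 1/1000 \<and> \<bar>w$2$1\<bar> < 1/1000 \<and>
                        \<bar>w$2$2 - 1\<bar> < 1/1000}"
  have "open T"
    unfolding T_def by (intro open_Collect_conj open_Collect_less continuous_intros)
  then have "openin (top_of_set SL2) (SL2 \<inter> T)" by (rule openin_open_Int)
  moreover have "SL2 \<inter> T = near_one" by (auto simp: near_one_def T_def)
  ultimately show ?thesis by simp
qed

lemma near_one_nonempty: "near_one \<noteq> {}"
proof -
  have "mat 1 \<in> near_one" by (simp add: near_one_def) (simp add: mat_def)
  then show ?thesis by blast
qed

section \<open>Perturbation estimates for rescaled hyperbolic matrices\<close>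

lemma product_perturb:
  fixes a b p q m :: real
  assumes "\<bar>p - a\<bar> \<le> 1/1000" "\<bar>q - b\<bar> \<le> 1/1000" "\<bar>a\<bar> \<le> 1" "\<bar>b\<bar> \<le> 1" "\<bar>m\<bar> \<le> 11/10"
  shows "\<bar>p * m * q - a * m * b\<bar> \<le> 23/10000"
proof -
  have "\<bar>q\<bar> \<le> 1001/1000" using assms by linarith
  then have "\<bar>(p - a) * q\<bar> \<le> 1/1000 * (1001/1000)" "\<bar>a * (q - b)\<bar> \<le> 1 * (1/1000)"
    unfolding abs_mult using assms by (intro mult_mono; simp)+
  then have "\<bar>(p - a) * q + a * (q - b)\<bar> \<le> 2001/1000000" by linarith
  then have "\<bar>((p - a) * q + a * (q - b)) * m\<bar> \<le> 2001/1000000 * (11/10)"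
    unfolding abs_mult using assms by (intro mult_mono; simp)
  moreover have "((p - a) * q + a * (q - b)) * m = p * m * q - a * m * b" by (simp add: algebra_simps)
  ultimately show ?thesis by simp
qed

text \<open>Each entry of the triple product has four summands, and four errors of
  \<open>23/10000\<close> stay below \<open>1/100\<close>.\<close>

lemma near_one_perturb:
  assumes w: "w \<in> near_one" "w' \<in> near_one" and M: "\<And>i j. \<bar>M$i$j\<bar> \<le> 11/10"
  shows "entries_close (1/100) (adj2 w ** M ** w') M"
proof -
  \<comment> \<open>The Kronecker symbol writes \<open>M\<close> as identity times \<open>M\<close>
    times identity, to be compared summand by summand.\<close>
  define \<delta> :: "2 \<Rightarrow> 2 \<Rightarrow> real" where "\<delta> i j = (if i = j then 1 else 0)" for i j
  have \<delta>: "\<delta> 1 1 = 1" "\<delta> 1 2 = 0" "\<delta> 2 1 = 0" "\<delta> 2 2 = 1" by (simp_all add: \<delta>_def)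
  have "\<forall>i j. \<bar>adj2 w$i$j - \<delta> i j\<bar> \<le> 1/1000" "\<forall>i j. \<bar>w'$i$j - \<delta> i j\<bar> \<le> 1/1000"
    using w unfolding forall_2 \<delta> by (simp_all add: near_one_def adj2_def)
  then have adj: "\<bar>adj2 w$i$j - \<delta> i j\<bar> \<le> 1/1000" and w': "\<bar>w'$i$j - \<delta> i j\<bar> \<le> 1/1000" for i j
    by blast+
  have entry: "\<bar>adj2 w$i$k * M$k$l * w'$l$j - \<delta> i k * M$k$l * \<delta> l j\<bar> \<le> 23/10000" for i j k l
    by (rule product_perturb) (use adj w' M in \<open>auto simp: \<delta>_def\<close>)
  have "\<bar>(adj2 w ** M ** w')$i$j - M$i$j\<bar> \<le> 1/100" for i j
  proof -
    have "(adj2 w ** M ** w')$i$j = (\<Sum>k\<in>UNIV. \<Sum>l\<in>UNIV. adj2 w$i$k * M$k$l * w'$l$j)"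
      by (simp add: matrix_matrix_mult_def sum_2 algebra_simps)
    moreover have "M$i$j = (\<Sum>k\<in>UNIV. \<Sum>l\<in>UNIV. \<delta> i k * M$k$l * \<delta> l j)"
      using exhaust_2[of i] exhaust_2[of j] by (elim disjE) (simp_all add: sum_2 \<delta>)
    ultimately show ?thesis
      using entry[of i 1 1 j] entry[of i 1 2 j] entry[of i 2 1 j] entry[of i 2 2 j]
      by (simp only: sum_2)
  qed
  then show ?thesis by (simp add: entries_close_def)
qed

text \<open>The bound \<open>1/50\<close> collects two errors of \<open>1/100\<close>: one from the
  factors \<open>w\<close> and \<open>w'\<close>, one from replacing the rescaled \<open>U\<close>
  by its limit \<open>Q\<close>.\<close>

lemma near_one_hyp:
  fixes Q U M :: "real^2^2"
  assumes w: "w \<in> near_one" "w' \<in> near_one" and U: "U = t *\<^sub>R M"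
    and M: "entries_close (1/100) M Q" and Q: "\<And>i j. \<bar>Q$i$j\<bar> \<le> 1"
  obtains P where "adj2 w ** U ** w' = t *\<^sub>R P" "entries_close (1/50) P Q"
proof
  show "adj2 w ** U ** w' = t *\<^sub>R (adj2 w ** M ** w')" by (simp add: U)
  have "\<bar>M$i$j\<bar> \<le> 11/10" for i j
  proof -
    have "\<bar>M$i$j - Q$i$j\<bar> \<le> 1/100" using M unfolding entries_close_def by blast
    then show ?thesis using Q[of i j] by linarith
  qed
  then have *: "entries_close (1/100) (adj2 w ** M ** w') M" by (rule near_one_perturb[OF w])
  show "entries_close (1/50) (adj2 w ** M ** w') Q"
    unfolding entries_close_def
  proof (intro allI)
    fix i j
    have "\<bar>(adj2 w ** M ** w')$i$j - M$i$j\<bar> \<le> 1/100" "\<bar>M$i$j - Q$i$j\<bar> \<le> 1/100"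
      using * M unfolding entries_close_def by blast+
    then show "\<bar>(adj2 w ** M ** w')$i$j - Q$i$j\<bar> \<le> 1/50" by linarith
  qed
qed

text \<open>Here and in \<open>proj_sym\<close>: the limit of the hyperbolic matrices divided by
  \<open>100 ^ n\<close>, that is, the orthogonal projection onto the expanding eigenline.\<close>

definition proj_diag :: "real^2^2" where
  "proj_diag = vector [vector [1, 0], vector [0, 0]]"

definition proj_sym :: "real^2^2" where
  "proj_sym = vector [vector [1/2, 1/2], vector [1/2, 1/2]]"

lemma hundred_power:
  assumes "n \<ge> 1" shows "(100::real) ^ n \<ge> 100" "1 / (100 ^ n)\<^sup>2 \<le> (1/100 :: real)"
proof -
  show *: "(100::real) ^ n \<ge> 100" using power_increasing[OF assms, of "100::real"] by simp
  have "(100::real)\<^sup>2 \<le> (100 ^ n)\<^sup>2" using * by (intro power_mono) auto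
  then show "1 / (100 ^ n)\<^sup>2 \<le> (1/100 :: real)" by (simp add: field_simps)
qed

lemma near_hyp_diag:
  assumes "n \<ge> 1" "w \<in> near_one" "w' \<in> near_one"
  obtains t P where "t \<ge> 100" "adj2 w ** hyp_diag n ** w' = t *\<^sub>R P" "entries_close (1/50) P proj_diag"
proof -
  define t :: real where "t = 100 ^ n"
  have t: "t \<ge> 100" "1 / t\<^sup>2 \<le> 1/100" using hundred_power[OF assms(1)] by (auto simp: t_def)
  define M :: "real^2^2" where "M = vector [vector [1, 0], vector [0, 1 / t\<^sup>2]]"
  have "hyp_diag n = t *\<^sub>R M"
    using t unfolding hyp_diag_def M_def t_def[symmetric] power_one_over
    by (simp add: diag_mat_def mat2_simps power2_eq_square)
  moreover have "entries_close (1/100) M proj_diag"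
    using t unfolding entries_close_def forall_2 by (simp add: M_def proj_diag_def)
  moreover have "\<bar>proj_diag$i$j\<bar> \<le> 1" for i j
    using exhaust_2[of i] exhaust_2[of j] by (auto simp: proj_diag_def)
  ultimately obtain P where "adj2 w ** hyp_diag n ** w' = t *\<^sub>R P" "entries_close (1/50) P proj_diag"
    using near_one_hyp[OF assms(2,3)] by blast
  then show ?thesis using that t by blast
qed

lemma near_hyp_sym:
  assumes "n \<ge> 1" "w \<in> near_one" "w' \<in> near_one"
  obtains t P where "t \<ge> 100" "adj2 w ** hyp_sym n ** w' = t *\<^sub>R P" "entries_close (1/50) P proj_sym"
proof -
  define t :: real where "t = 100 ^ n"
  have t: "t \<ge> 100" "1 / t\<^sup>2 \<le> 1/100" using hundred_power[OF assms(1)] by (auto simp: t_def)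
  define s where "s = 1 / t\<^sup>2"
  have s: "0 \<le> s" "s \<le> 1/100" "t * s = 1 / t" using t by (auto simp: s_def power2_eq_square)
  define M :: "real^2^2" where
    "M = vector [vector [(1 + s) / 2, (1 - s) / 2], vector [(1 - s) / 2, (1 + s) / 2]]"
  have "hyp_sym n = t *\<^sub>R M"
    using s unfolding hyp_sym_def M_def t_def[symmetric] power_one_over
    by (simp add: sym_mat_def mat2_simps algebra_simps)
  moreover have "entries_close (1/100) M proj_sym"
    using s unfolding entries_close_def forall_2 by (simp add: M_def proj_sym_def)
  moreover have "\<bar>proj_sym$i$j\<bar> \<le> 1" for i j
    using exhaust_2[of i] exhaust_2[of j] by (auto simp: proj_sym_def)
  ultimately obtain P where "adj2 w ** hyp_sym n ** w' = t *\<^sub>R P" "entries_close (1/50) P proj_sym"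
    using near_one_hyp[OF assms(2,3)] by blast
  then show ?thesis using that t by blast
qed

lemma mult_bounds:
  fixes a b a' b' x y :: real
  assumes "a \<le> x" "x \<le> b" "a' \<le> y" "y \<le> b'" "0 \<le> a" "0 \<le> a'"
  shows "a * a' \<le> x * y" "x * y \<le> b * b'"
  using assms by (auto intro!: mult_mono)

text \<open>The commutator determinant is governed by its term of order
  \<open>s\<^sup>2 * t\<^sup>2\<close>, whose coefficient \<open>z * (x * y - z)\<close> is close to
  \<open>1/4\<close>. The squared traces of \<open>A\<close> and \<open>B\<close> only grow like
  \<open>s\<^sup>2\<close> and \<open>t\<^sup>2\<close>.\<close>

lemma hyp_pair_nondegenerate:
  fixes A B P Q :: "real^2^2"
  assumes A: "A = s *\<^sub>R P" "det A = 1" "s \<ge> 100" and P: "entries_close (1/50) P proj_diag"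
    and B: "B = t *\<^sub>R Q" "det B = 1" "t \<ge> 100" and Q: "entries_close (1/50) Q proj_sym"
  shows "trace A > 2" "trace B \<noteq> 0" "trace (A ** B) \<noteq> 0" "det (A ** B - B ** A) \<noteq> 0"
proof -
  have p: "\<bar>P$1$1 - 1\<bar> \<le> 1/50" "\<bar>P$1$2\<bar> \<le> 1/50" "\<bar>P$2$1\<bar> \<le> 1/50" "\<bar>P$2$2\<bar> \<le> 1/50"
    using P unfolding entries_close_def forall_2 by (auto simp: proj_diag_def)
  have q: "\<bar>Q$1$1 - 1/2\<bar> \<le> 1/50" "\<bar>Q$1$2 - 1/2\<bar> \<le> 1/50" "\<bar>Q$2$1 - 1/2\<bar> \<le> 1/50"
    "\<bar>Q$2$2 - 1/2\<bar> \<le> 1/50"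
    using Q unfolding entries_close_def forall_2 by (auto simp: proj_sym_def)
  define x y z where "x = trace P" "y = trace Q" "z = trace (P ** Q)"
  have x: "24/25 \<le> x" "x \<le> 26/25" using p unfolding x_y_z_def trace_def sum_2 by linarith+
  have y: "24/25 \<le> y" "y \<le> 26/25" using q unfolding x_y_z_def trace_def sum_2 by linarith+
  have z: "43/100 \<le> z" "z \<le> 57/100"
  proof -
    have z: "z = P$1$1 * Q$1$1 + P$1$2 * Q$2$1 + P$2$1 * Q$1$2 + P$2$2 * Q$2$2"
      by (simp add: x_y_z_def trace_def sum_2 matrix_matrix_mult_def)
    have pq: "49/50 \<le> P$1$1" "P$1$1 \<le> 51/50" "24/50 \<le> Q$1$1" "Q$1$1 \<le> 26/50"
      using p(1) q(1) by linarith+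
    have 1: "49/50 * (24/50) \<le> P$1$1 * Q$1$1" "P$1$1 * Q$1$1 \<le> 51/50 * (26/50)"
      using mult_bounds[OF pq] by simp_all
    have small: "\<bar>a * b\<bar> \<le> 1/50 * (26/50)" if "\<bar>a\<bar> \<le> 1/50" "\<bar>b - 1/2\<bar> \<le> 1/50" for a b :: real
    proof -
      have "\<bar>b\<bar> \<le> 26/50" using that(2) by linarith
      then show ?thesis unfolding abs_mult using that(1) by (intro mult_mono) auto
    qed
    show "43/100 \<le> z" "z \<le> 57/100"
      using 1 small[OF p(2) q(3)] small[OF p(3) q(2)] small[OF p(4) q(4)] unfolding z by linarith+
  qed
  have tr: "trace A = s * x" "trace B = t * y" "trace (A ** B) = s * t * z"
    unfolding A(1) B(1) x_y_z_def by (auto simp: trace_def sum_2 matrix_matrix_mult_def algebra_simps)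
  have "100 * (24/25) \<le> s * x" using x A(3) by (intro mult_mono) auto
  then show "trace A > 2" using tr by simp
  show "trace B \<noteq> 0" using tr y B(3) by auto
  show "trace (A ** B) \<noteq> 0" using tr z A(3) B(3) by auto
  have sq: "x\<^sup>2 \<le> 2" "y\<^sup>2 \<le> 2"
    using mult_bounds(2)[OF x x] mult_bounds(2)[OF y y] by (auto simp: power2_eq_square)
  have "(24/25) * (24/25) \<le> x * y" using mult_bounds(1)[OF x y] by simp
  \<comment> \<open>The factor \<open>35/100\<close> is a lower bound for \<open>x * y - z\<close>,
    coming from \<open>(24/25)\<^sup>2 - 57/100\<close>.\<close>
  then have "43/100 * (35/100) \<le> z * (x * y - z)" using z by (intro mult_mono) auto
  then have main: "15/100 * (s\<^sup>2 * t\<^sup>2) \<le> z * (x * y - z) * (s\<^sup>2 * t\<^sup>2)" by (intro mult_right_mono) auto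
  have st: "100\<^sup>2 \<le> s\<^sup>2" "100\<^sup>2 \<le> t\<^sup>2" using A(3) B(3) by (intro power_mono; simp)+
  have "10000 * s\<^sup>2 \<le> s\<^sup>2 * t\<^sup>2" "10000 * t\<^sup>2 \<le> s\<^sup>2 * t\<^sup>2"
    using mult_left_mono[OF st(2), of "s\<^sup>2"] mult_right_mono[OF st(1), of "t\<^sup>2"] by auto
  moreover have "s\<^sup>2 * x\<^sup>2 \<le> s\<^sup>2 * 2" "t\<^sup>2 * y\<^sup>2 \<le> t\<^sup>2 * 2" using sq by (intro mult_left_mono; simp)+
  moreover have "det (A ** B - B ** A) =
      4 - s\<^sup>2 * x\<^sup>2 - t\<^sup>2 * y\<^sup>2 + z * (x * y - z) * (s\<^sup>2 * t\<^sup>2)"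
    unfolding det_commutator[OF A(2) B(2)] tr by (simp add: power2_eq_square algebra_simps)
  ultimately show "det (A ** B - B ** A) \<noteq> 0" using main st zero_le_power2[of "s * t"]
    unfolding power_mult_distrib by linarith
qed

text \<open>The two recurrences use the same labels but different eigenlines, which is what keeps
  the commutator invertible.\<close>

lemma lattice_nondegenerate_pair:
  fixes \<Gamma> :: "('a, 'b) monoid_scheme"
  assumes "group \<Gamma>" "\<rho> \<in> hom \<Gamma> PSL2R"
    and "lattice_in PSL2R PSL2R_topology (\<rho> ` carrier \<Gamma>)"
    and "finite (\<kappa> ` carrier \<Gamma>)"
  obtains g g' h h' A B where "g \<in> carrier \<Gamma>" "g' \<in> carrier \<Gamma>" "\<kappa> g = \<kappa> g'"
    "h \<in> carrier \<Gamma>" "h' \<in> carrier \<Gamma>" "\<kappa> h = \<kappa> h'"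
    "\<rho> (inv\<^bsub>\<Gamma>\<^esub> g \<otimes>\<^bsub>\<Gamma>\<^esub> g') = psl A" "\<rho> (inv\<^bsub>\<Gamma>\<^esub> h \<otimes>\<^bsub>\<Gamma>\<^esub> h') = psl B" "det A = 1" "det B = 1"
    "trace A > 2" "trace B \<noteq> 0" "trace (A ** B) \<noteq> 0" "det (A ** B - B ** A) \<noteq> 0"
proof -
  obtain n w w' g g' where 1: "n \<ge> 1" "w \<in> near_one" "w' \<in> near_one" "g \<in> carrier \<Gamma>"
    "g' \<in> carrier \<Gamma>" "\<kappa> g = \<kappa> g'" "\<rho> (inv\<^bsub>\<Gamma>\<^esub> g \<otimes>\<^bsub>\<Gamma>\<^esub> g') = psl (adj2 w ** hyp_diag n ** w')"
    by (rule lattice_recurrence[where U = hyp_diag and V = near_one,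
          OF assms near_one_open near_one_nonempty hyp_diag_SL2 hyp_diag_add])
  obtain m v v' h h' where 2: "m \<ge> 1" "v \<in> near_one" "v' \<in> near_one" "h \<in> carrier \<Gamma>"
    "h' \<in> carrier \<Gamma>" "\<kappa> h = \<kappa> h'" "\<rho> (inv\<^bsub>\<Gamma>\<^esub> h \<otimes>\<^bsub>\<Gamma>\<^esub> h') = psl (adj2 v ** hyp_sym m ** v')"
    by (rule lattice_recurrence[where U = hyp_sym and V = near_one,
          OF assms near_one_open near_one_nonempty hyp_sym_SL2 hyp_sym_add])
  obtain s P where P: "s \<ge> 100" "adj2 w ** hyp_diag n ** w' = s *\<^sub>R P" "entries_close (1/50) P proj_diag"
    by (rule near_hyp_diag[OF 1(1-3)])
  obtain t Q where Q: "t \<ge> 100" "adj2 v ** hyp_sym m ** v' = t *\<^sub>R Q" "entries_close (1/50) Q proj_sym"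
    by (rule near_hyp_sym[OF 2(1-3)])
  have det: "det (adj2 w ** hyp_diag n ** w') = 1" "det (adj2 v ** hyp_sym m ** v') = 1"
    using 1(2,3) 2(2,3) hyp_diag_SL2[of n] hyp_sym_SL2[of m] by (auto simp: det_mul near_one_def)
  show ?thesis
    by (rule that[OF 1(4-6) 2(4-6) 1(7) 2(7) det
          hyp_pair_nondegenerate[OF P(2) det(1) P(1,3) Q(2) det(2) Q(1,3)]])
qed

section \<open>Rigidity\<close>

lemma trace_square_cong: "psl A = psl B \<Longrightarrow> (trace A)\<^sup>2 = (trace B)\<^sup>2"
  by (metis tr2_psl)

lemma psl_det: "psl A \<in> carrier PSL2R \<Longrightarrow> det A = 1"
  by (auto simp: carrier_PSL2R psl_eq_iff)

lemma psl_lift_trace: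
  assumes "(trace A)\<^sup>2 = (trace B)\<^sup>2"
  obtains B' where "psl B' = psl B" "trace B' = trace A"
proof (cases "trace A = trace B")
  case True
  then show ?thesis using that by metis
next
  case False
  then have "trace (- B) = trace A" using assms by (simp add: power2_eq_iff)
  then show ?thesis using that[of "- B"] by (simp add: psl_eq_iff)
qed

text \<open>Conjugation by \<open>H\<close> preserves the trace but multiplies \<open>A\<close> by
  \<open>c\<close>, which forces \<open>c = 1\<close>. This turns commutation in a projective group
  into commutation of matrices.\<close>

lemma scaled_commute:
  fixes A H :: "real^2^2"
  assumes "invertible H" "H ** A = c *\<^sub>R (A ** H)" "trace A \<noteq> 0"
  shows "H ** A = A ** H"
proof -
  obtain K where K: "H ** K = mat 1" "K ** H = mat 1" using assms(1) by (auto simp: invertible_def)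
  have "trace A = trace (H ** A ** K)" using trace_conj[OF K(2)] by simp
  also have "\<dots> = trace (c *\<^sub>R (A ** (H ** K)))" by (simp add: assms(2) matrix_mul_assoc)
  also have "\<dots> = c * trace A" by (simp add: K) (simp add: trace_def sum_2 algebra_simps)
  finally have "c = 1" using assms(3) by simp
  then show ?thesis using assms(2) by simp
qed

lemma (in group) conj_eq_commute:
  assumes "f \<in> carrier G" "f' \<in> carrier G" "x \<in> carrier G"
    and "f \<otimes> x \<otimes> inv f = f' \<otimes> x \<otimes> inv f'"
  shows "inv f' \<otimes> f \<otimes> x = x \<otimes> (inv f' \<otimes> f)"
proof -
  have "inv f' \<otimes> f \<otimes> x = inv f' \<otimes> (f \<otimes> x \<otimes> inv f) \<otimes> f"
    using assms(1-3) by (simp add: m_assoc)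
  also have "\<dots> = x \<otimes> (inv f' \<otimes> f)"
    unfolding assms(4) using assms(1-3) by (simp flip: m_assoc)
  finally show ?thesis .
qed

section \<open>Comparing two projective representations through matrix lifts of arbitrary
  sign\<close>

context
  fixes \<Gamma> :: "('a, 'b) monoid_scheme" and F F' :: "'a \<Rightarrow> real^2^2" and \<Delta> :: "'a set"
  assumes \<Gamma>: "group \<Gamma>"
    and hom: "(\<lambda>g. psl (F g)) \<in> hom \<Gamma> PSL2R" "(\<lambda>g. psl (F' g)) \<in> hom \<Gamma> PSL2R"
    and \<Delta>: "subgroup \<Delta> \<Gamma>"
    and tr: "\<And>g. g \<in> \<Delta> \<Longrightarrow> (trace (F g))\<^sup>2 = (trace (F' g))\<^sup>2"
begin

interpretation \<Gamma>: group \<Gamma> by (rule \<Gamma>)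
interpretation \<Delta>: subgroup \<Delta> \<Gamma> by (rule \<Delta>)
interpretation F: group_hom \<Gamma> PSL2R "\<lambda>g. psl (F g)"
  using \<Gamma> group_PSL2R hom by (simp add: group_hom_def group_hom_axioms_def)
interpretation F': group_hom \<Gamma> PSL2R "\<lambda>g. psl (F' g)"
  using \<Gamma> group_PSL2R hom by (simp add: group_hom_def group_hom_axioms_def)

lemma det_lift: "g \<in> carrier \<Gamma> \<Longrightarrow> det (F g) = 1" "g \<in> carrier \<Gamma> \<Longrightarrow> det (F' g) = 1"
  using psl_det F.hom_closed F'.hom_closed by blast+

text \<open>The traces of \<open>A B\<close> and \<open>A B\<^sup>-\<^sup>1\<close> add up to \<open>trace A * trace B\<close>, so the squares of both
  determine the sign of each.\<close>

lemma trace_product_eq: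
  assumes g: "g \<in> \<Delta>" "psl A = psl (F g)" "psl A' = psl (F' g)" "trace A = trace A'" "trace A \<noteq> 0"
    and h: "h \<in> \<Delta>" "psl B = psl (F h)" "psl B' = psl (F' h)" "trace B = trace B'" "trace B \<noteq> 0"
  shows "trace (A ** B) = trace (A' ** B')"
proof -
  have gh: "g \<in> carrier \<Gamma>" "h \<in> carrier \<Gamma>" using g h by auto
  have det: "det B = 1" "det B' = 1"
    using F.hom_closed[OF gh(2)] F'.hom_closed[OF gh(2)] h(2,3) by (metis psl_det)+
  have "psl (A ** B) = psl (F (g \<otimes>\<^bsub>\<Gamma>\<^esub> h))" "psl (A' ** B') = psl (F' (g \<otimes>\<^bsub>\<Gamma>\<^esub> h))"
    using F.hom_mult[OF gh] F'.hom_mult[OF gh] g h by (metis psl_mult)+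
  then have 1: "(trace (A ** B))\<^sup>2 = (trace (A' ** B'))\<^sup>2"
    using tr[of "g \<otimes>\<^bsub>\<Gamma>\<^esub> h"] g h trace_square_cong by (metis \<Delta>.m_closed)
  have "psl (A ** adj2 B) = psl (F (g \<otimes>\<^bsub>\<Gamma>\<^esub> inv\<^bsub>\<Gamma>\<^esub> h))"
    "psl (A' ** adj2 B') = psl (F' (g \<otimes>\<^bsub>\<Gamma>\<^esub> inv\<^bsub>\<Gamma>\<^esub> h))"
    using F.hom_mult[OF gh(1)] F'.hom_mult[OF gh(1)] F.hom_inv[OF gh(2)] F'.hom_inv[OF gh(2)] gh g h
      psl_inv[OF det(1)] psl_inv[OF det(2)] by (metis psl_mult \<Gamma>.inv_closed)+
  then have 2: "(trace (A ** adj2 B))\<^sup>2 = (trace (A' ** adj2 B'))\<^sup>2"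
    using tr[of "g \<otimes>\<^bsub>\<Gamma>\<^esub> inv\<^bsub>\<Gamma>\<^esub> h"] g h trace_square_cong by (metis \<Delta>.m_closed \<Delta>.m_inv_closed)
  show ?thesis
    by (rule square_sign_eq[OF g(5) h(5) 1]) (use 2 g(4) h(4) in \<open>simp add: trace_mult_adj2\<close>)
qed

text \<open>For an element of non-zero trace, a lift with the right sign has the same traces against
  the basis \<open>1, A, B, A B\<close>. The remaining elements are first multiplied by a basis
  element.\<close>

lemma rigid_on_subgroup:
  assumes a: "a \<in> \<Delta>" "psl A = psl (F a)" "psl A = psl (F' a)" "trace A \<noteq> 0"
    and b: "b \<in> \<Delta>" "psl B = psl (F b)" "psl B = psl (F' b)" "trace B \<noteq> 0"
    and AB: "trace (A ** B) \<noteq> 0" "det (A ** B - B ** A) \<noteq> 0"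
    and g: "g \<in> \<Delta>"
  shows "psl (F g) = psl (F' g)"
proof -
  have ab: "a \<otimes>\<^bsub>\<Gamma>\<^esub> b \<in> \<Delta>" "psl (A ** B) = psl (F (a \<otimes>\<^bsub>\<Gamma>\<^esub> b))" "psl (A ** B) = psl (F' (a \<otimes>\<^bsub>\<Gamma>\<^esub> b))"
    using a b by (auto simp flip: psl_mult)
  have step: "psl (F g) = psl (F' g)" if g: "g \<in> \<Delta>" "trace (F g) \<noteq> 0" for g
  proof -
    obtain C where C: "psl C = psl (F' g)" "trace C = trace (F g)"
      by (rule psl_lift_trace[OF tr[OF g(1)]])
    have eq: "trace (F g ** X) = trace (C ** X)"
      if "x \<in> \<Delta>" "psl X = psl (F x)" "psl X = psl (F' x)" "trace X \<noteq> 0" for x X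
      using trace_product_eq[of g "F g" C x X X] C g that by simp
    have "trace ((F g - C) ** X) = trace (F g ** X) - trace (C ** X)" for X
      by (simp add: trace_def sum_2 matrix_matrix_mult_def algebra_simps)
    moreover have "trace (F g - C) = 0" using C by (simp add: trace_def sum_2)
    ultimately have "F g - C = 0"
      using eq[OF a] eq[OF b] eq[OF ab AB(1)] by (intro trace_form_nondegenerate[OF AB(2)]) auto
    then show ?thesis using C by simp
  qed
  \<comment> \<open>A vanishing trace fixes no sign. Passing to the product of \<open>g\<close> and
    \<open>x\<close> restores a non-zero trace, and \<open>x\<close> cancels afterwards.\<close>
  have right: ?thesis if x: "x \<in> \<Delta>" "psl X = psl (F x)" "psl X = psl (F' x)" "trace (F g ** X) \<noteq> 0" for x X
  proof -
    have car: "g \<in> carrier \<Gamma>" "x \<in> carrier \<Gamma>" using g x by auto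
    have gx: "psl (F (g \<otimes>\<^bsub>\<Gamma>\<^esub> x)) = psl (F g ** X)"
      using F.hom_mult[OF car] x by (simp flip: psl_mult)
    then have "(trace (F (g \<otimes>\<^bsub>\<Gamma>\<^esub> x)))\<^sup>2 = (trace (F g ** X))\<^sup>2" by (rule trace_square_cong)
    then have "trace (F (g \<otimes>\<^bsub>\<Gamma>\<^esub> x)) \<noteq> 0" using x by auto
    then have "psl (F (g \<otimes>\<^bsub>\<Gamma>\<^esub> x)) = psl (F' (g \<otimes>\<^bsub>\<Gamma>\<^esub> x))" using step g x by simp
    then have "psl (F g) \<otimes>\<^bsub>PSL2R\<^esub> psl X = psl (F' g) \<otimes>\<^bsub>PSL2R\<^esub> psl X"
      using F.hom_mult[OF car] F'.hom_mult[OF car] x(2,3) by metis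
    then show ?thesis
      using group.right_cancel[OF group_PSL2R] F.hom_closed F'.hom_closed car x by metis
  qed
  \<comment> \<open>A non-zero matrix cannot be orthogonal to the whole basis under the trace form,
    so one of the four cases provides a usable factor.\<close>
  have "F g \<noteq> 0" using det_lift(1)[of g] g by (auto simp: det_2)
  then consider "trace (F g) \<noteq> 0" | "trace (F g ** A) \<noteq> 0" | "trace (F g ** B) \<noteq> 0"
    | "trace (F g ** (A ** B)) \<noteq> 0"
    using trace_form_nondegenerate[OF AB(2)] by blast
  then show ?thesis
    using step[OF g] right[OF a(1-3)] right[OF b(1-3)] right[OF ab] by cases auto
qed

text \<open>Both images of \<open>g\<close> conjugate \<open>a\<close> and \<open>b\<close> in the
  same way, since the conjugates lie in \<open>\<Delta>\<close>. The quotient \<open>H\<close> of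
  the lifts therefore commutes with a generating pair of the matrix algebra, and its determinant
  leaves only \<open>1\<close> and \<open>- 1\<close>.\<close>

lemma rigid_on_group:
  assumes eq: "\<And>h. h \<in> \<Delta> \<Longrightarrow> psl (F h) = psl (F' h)" and g: "g \<in> carrier \<Gamma>"
    and a: "a \<in> \<Delta>" "g \<otimes>\<^bsub>\<Gamma>\<^esub> a \<otimes>\<^bsub>\<Gamma>\<^esub> inv\<^bsub>\<Gamma>\<^esub> g \<in> \<Delta>" "psl A = psl (F a)" "trace A \<noteq> 0"
    and b: "b \<in> \<Delta>" "g \<otimes>\<^bsub>\<Gamma>\<^esub> b \<otimes>\<^bsub>\<Gamma>\<^esub> inv\<^bsub>\<Gamma>\<^esub> g \<in> \<Delta>" "psl B = psl (F b)" "trace B \<noteq> 0"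
    and AB: "det (A ** B - B ** A) \<noteq> 0"
  shows "psl (F g) = psl (F' g)"
proof -
  note det = det_lift[OF g]
  define H where "H = adj2 (F' g) ** F g"
  have H: "det H = 1" "psl H = inv\<^bsub>PSL2R\<^esub> (psl (F' g)) \<otimes>\<^bsub>PSL2R\<^esub> psl (F g)"
    using det by (auto simp: H_def det_mul psl_inv)
  then have inv: "invertible H" by (simp add: invertible_det_nz)
  have commute: "H ** X = X ** H"
    if x: "x \<in> \<Delta>" "g \<otimes>\<^bsub>\<Gamma>\<^esub> x \<otimes>\<^bsub>\<Gamma>\<^esub> inv\<^bsub>\<Gamma>\<^esub> g \<in> \<Delta>" "psl X = psl (F x)" "trace X \<noteq> 0" for x X
  proof -
    let ?f = "psl (F g)" and ?f' = "psl (F' g)" and ?x = "psl X"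
    have car: "?f \<in> carrier PSL2R" "?f' \<in> carrier PSL2R" "?x \<in> carrier PSL2R"
      using F.hom_closed[OF g] F'.hom_closed[OF g] F.hom_closed[of x] x by auto
    have xc: "x \<in> carrier \<Gamma>" using x by simp
    have "psl (F (g \<otimes>\<^bsub>\<Gamma>\<^esub> x \<otimes>\<^bsub>\<Gamma>\<^esub> inv\<^bsub>\<Gamma>\<^esub> g)) = ?f \<otimes>\<^bsub>PSL2R\<^esub> ?x \<otimes>\<^bsub>PSL2R\<^esub> inv\<^bsub>PSL2R\<^esub> ?f"
      using F.hom_mult[of "g \<otimes>\<^bsub>\<Gamma>\<^esub> x" "inv\<^bsub>\<Gamma>\<^esub> g"] F.hom_mult[OF g xc] F.hom_inv[OF g] g xc x(3)
      by (simp del: psl_mult)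
    moreover have "psl (F' (g \<otimes>\<^bsub>\<Gamma>\<^esub> x \<otimes>\<^bsub>\<Gamma>\<^esub> inv\<^bsub>\<Gamma>\<^esub> g)) = ?f' \<otimes>\<^bsub>PSL2R\<^esub> ?x \<otimes>\<^bsub>PSL2R\<^esub> inv\<^bsub>PSL2R\<^esub> ?f'"
      using F'.hom_mult[of "g \<otimes>\<^bsub>\<Gamma>\<^esub> x" "inv\<^bsub>\<Gamma>\<^esub> g"] F'.hom_mult[OF g xc] F'.hom_inv[OF g] g xc x(3)
        eq[OF x(1)] by (simp del: psl_mult)
    ultimately have "?f \<otimes>\<^bsub>PSL2R\<^esub> ?x \<otimes>\<^bsub>PSL2R\<^esub> inv\<^bsub>PSL2R\<^esub> ?f = ?f' \<otimes>\<^bsub>PSL2R\<^esub> ?x \<otimes>\<^bsub>PSL2R\<^esub> inv\<^bsub>PSL2R\<^esub> ?f'"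
      using eq[OF x(2)] by simp
    then have "inv\<^bsub>PSL2R\<^esub> ?f' \<otimes>\<^bsub>PSL2R\<^esub> ?f \<otimes>\<^bsub>PSL2R\<^esub> ?x = ?x \<otimes>\<^bsub>PSL2R\<^esub> (inv\<^bsub>PSL2R\<^esub> ?f' \<otimes>\<^bsub>PSL2R\<^esub> ?f)"
      using group.conj_eq_commute[OF group_PSL2R] car by blast
    then have "psl H \<otimes>\<^bsub>PSL2R\<^esub> ?x = ?x \<otimes>\<^bsub>PSL2R\<^esub> psl H"
      by (simp only: H(2))
    \<comment> \<open>In \<open>PSL2R\<close> commuting means commuting up to sign; the non-zero
      trace of \<open>X\<close> excludes the sign \<open>- 1\<close>.\<close>
    then have "H ** X = 1 *\<^sub>R (X ** H) \<or> H ** X = (- 1) *\<^sub>R (X ** H)" by (simp add: psl_eq_iff)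
    then show ?thesis using scaled_commute[OF inv _ x(4)] by blast
  qed
  have "H = (H$1$1) *\<^sub>R mat 1"
    using centralizer_scalar[OF AB] commute[OF a] commute[OF b] by blast
  then obtain c where c: "H = c *\<^sub>R mat 1" by blast
  then have "c\<^sup>2 = 1" using H(1) by (simp add: det_2 mat_def power2_eq_square)
  then have "psl H = psl (mat 1)" unfolding c by (auto simp: power2_eq_1_iff psl_eq_iff)
  then have "psl (F' g) \<otimes>\<^bsub>PSL2R\<^esub> psl H = psl (F' g)" by simp
  moreover have "F' g ** H = F g" using det by (simp add: H_def matrix_mul_assoc adj2_mult)
  ultimately show ?thesis by simp
qed

end

text \<open>The intersection of \<open>\<Delta>\<close> with
  \<open>c\<^sup>-\<^sup>1 \<Delta> c\<close> again has finite index; recurrence reaches it through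
  a label that records two cosets at once.\<close>

lemma finite_index_pair:
  fixes \<Gamma> :: "('a, 'b) monoid_scheme"
  assumes \<Gamma>: "group \<Gamma>" and \<rho>: "\<rho> \<in> hom \<Gamma> PSL2R"
    and lat: "lattice_in PSL2R PSL2R_topology (\<rho> ` carrier \<Gamma>)"
    and \<Delta>: "subgroup \<Delta> \<Gamma>" "finite (rcosets\<^bsub>\<Gamma>\<^esub> \<Delta>)" and c: "c \<in> carrier \<Gamma>"
  obtains a b A B where "a \<in> \<Delta>" "b \<in> \<Delta>" "c \<otimes>\<^bsub>\<Gamma>\<^esub> a \<otimes>\<^bsub>\<Gamma>\<^esub> inv\<^bsub>\<Gamma>\<^esub> c \<in> \<Delta>" "c \<otimes>\<^bsub>\<Gamma>\<^esub> b \<otimes>\<^bsub>\<Gamma>\<^esub> inv\<^bsub>\<Gamma>\<^esub> c \<in> \<Delta>"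
    "\<rho> a = psl A" "\<rho> b = psl B" "det A = 1" "det B = 1"
    "trace A > 2" "trace B \<noteq> 0" "trace (A ** B) \<noteq> 0" "det (A ** B - B ** A) \<noteq> 0"
proof -
  interpret \<Gamma>: group \<Gamma> by (rule \<Gamma>)
  interpret \<Delta>: subgroup \<Delta> \<Gamma> by (rule \<Delta>)
  \<comment> \<open>Inverses appear because the cosets are right cosets: equal first components put
    the quotient of \<open>g\<close> and \<open>g'\<close> into \<open>\<Delta>\<close>, equal
    second components do so for its conjugate by \<open>c\<close>.\<close>
  define \<kappa> where "\<kappa> g = (\<Delta> #>\<^bsub>\<Gamma>\<^esub> inv\<^bsub>\<Gamma>\<^esub> g, \<Delta> #>\<^bsub>\<Gamma>\<^esub> (c \<otimes>\<^bsub>\<Gamma>\<^esub> inv\<^bsub>\<Gamma>\<^esub> g))" for g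
  have "\<kappa> ` carrier \<Gamma> \<subseteq> (rcosets\<^bsub>\<Gamma>\<^esub> \<Delta>) \<times> (rcosets\<^bsub>\<Gamma>\<^esub> \<Delta>)"
    using c by (auto simp: \<kappa>_def intro!: \<Gamma>.rcosetsI \<Delta>.subset)
  then have fin: "finite (\<kappa> ` carrier \<Gamma>)" using \<Delta>(2) finite_subset by blast
  have coset: "x \<otimes>\<^bsub>\<Gamma>\<^esub> inv\<^bsub>\<Gamma>\<^esub> y \<in> \<Delta>" if xy: "x \<in> carrier \<Gamma>" "y \<in> carrier \<Gamma>" "\<Delta> #>\<^bsub>\<Gamma>\<^esub> x = \<Delta> #>\<^bsub>\<Gamma>\<^esub> y" for x y
    using \<Gamma>.rcos_self[OF xy(1) \<Delta>(1)] xy \<Delta>.rcos_module_imp[OF \<Gamma>, of y x] by simp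
  have in\<Delta>: "inv\<^bsub>\<Gamma>\<^esub> g \<otimes>\<^bsub>\<Gamma>\<^esub> g' \<in> \<Delta> \<and> c \<otimes>\<^bsub>\<Gamma>\<^esub> (inv\<^bsub>\<Gamma>\<^esub> g \<otimes>\<^bsub>\<Gamma>\<^esub> g') \<otimes>\<^bsub>\<Gamma>\<^esub> inv\<^bsub>\<Gamma>\<^esub> c \<in> \<Delta>"
    if g: "g \<in> carrier \<Gamma>" "g' \<in> carrier \<Gamma>" "\<kappa> g = \<kappa> g'" for g g'
  proof -
    have "inv\<^bsub>\<Gamma>\<^esub> g \<otimes>\<^bsub>\<Gamma>\<^esub> g' \<in> \<Delta>"
      using coset[of "inv\<^bsub>\<Gamma>\<^esub> g" "inv\<^bsub>\<Gamma>\<^esub> g'"] g by (simp add: \<kappa>_def)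
    moreover have "(c \<otimes>\<^bsub>\<Gamma>\<^esub> inv\<^bsub>\<Gamma>\<^esub> g) \<otimes>\<^bsub>\<Gamma>\<^esub> inv\<^bsub>\<Gamma>\<^esub> (c \<otimes>\<^bsub>\<Gamma>\<^esub> inv\<^bsub>\<Gamma>\<^esub> g') \<in> \<Delta>"
      using coset[of "c \<otimes>\<^bsub>\<Gamma>\<^esub> inv\<^bsub>\<Gamma>\<^esub> g" "c \<otimes>\<^bsub>\<Gamma>\<^esub> inv\<^bsub>\<Gamma>\<^esub> g'"] g c by (simp add: \<kappa>_def)
    ultimately show ?thesis using g c by (simp add: \<Gamma>.inv_mult_group \<Gamma>.m_assoc)
  qed
  show ?thesis
    by (rule lattice_nondegenerate_pair[OF \<Gamma> \<rho> lat fin]) (use that in\<Delta> in blast)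
qed

lemma psl_conj_cong:
  assumes "psl X = psl Y" shows "psl (T ** X ** S) = psl (T ** Y ** S)"
  using assms by (auto simp: psl_eq_iff)

text \<open>The witness is the larger root of \<open>m\<^sup>2 - x * m + 1\<close>, real because
  \<open>x > 2\<close>. It supplies the real eigenvalue that the normal form of a pair
  requires.\<close>

lemma trace_as_sum_inverse:
  fixes x :: real assumes "x > 2" obtains m where "m \<noteq> 0" "x = m + 1 / m"
proof -
  define r where "r = sqrt (x\<^sup>2 - 4)"
  have "2\<^sup>2 \<le> x\<^sup>2" using assms by (intro power_mono) auto
  then have r: "r \<ge> 0" "r\<^sup>2 = x\<^sup>2 - 4" by (auto simp: r_def)
  define m where "m = (x + r) / 2"
  have "m > 0" using assms r by (simp add: m_def)
  moreover have "m * m + 1 = x * m" using r(2) unfolding m_def power2_eq_square by (simp add: field_simps)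
  ultimately show ?thesis using that[of m] by (simp add: field_simps)
qed

theorem theorem6p1:
  fixes \<Gamma> :: "('a, 'b) monoid_scheme"
    and \<rho>\<^sub>1 \<rho>\<^sub>2 :: "'a \<Rightarrow> (real^2^2) set"
    and \<Delta> :: "'a set"
  assumes "group \<Gamma>"
    and "\<rho>\<^sub>1 \<in> hom \<Gamma> PSL2R" and "inj_on \<rho>\<^sub>1 (carrier \<Gamma>)"
    and "lattice_in PSL2R PSL2R_topology (\<rho>\<^sub>1 ` carrier \<Gamma>)"
    and "\<rho>\<^sub>2 \<in> hom \<Gamma> PSL2R" and "inj_on \<rho>\<^sub>2 (carrier \<Gamma>)"
    and "lattice_in PSL2R PSL2R_topology (\<rho>\<^sub>2 ` carrier \<Gamma>)"
    and "subgroup \<Delta> \<Gamma>" and "finite (rcosets\<^bsub>\<Gamma>\<^esub> \<Delta>)"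
    and "\<forall>\<gamma>\<in>\<Delta>. tr2 (\<rho>\<^sub>1 \<gamma>) = tr2 (\<rho>\<^sub>2 \<gamma>)"
  shows "\<exists>!a. a \<in> carrier PGL2R \<and>
           (\<forall>\<gamma>\<in>carrier \<Gamma>. PSL_to_PGL (\<rho>\<^sub>2 \<gamma>) =
              a \<otimes>\<^bsub>PGL2R\<^esub> PSL_to_PGL (\<rho>\<^sub>1 \<gamma>) \<otimes>\<^bsub>PGL2R\<^esub> inv\<^bsub>PGL2R\<^esub> a)"
proof -
  interpret \<Gamma>: group \<Gamma> by (rule assms)
  interpret \<Delta>: subgroup \<Delta> \<Gamma> by (rule assms)
  have "\<exists>A. \<rho> g = psl A" if "\<rho> \<in> hom \<Gamma> PSL2R" "g \<in> carrier \<Gamma>" for \<rho> g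
    using hom_in_carrier[OF that] by (auto simp: carrier_PSL2R)
  then obtain F F' where F: "\<And>g. g \<in> carrier \<Gamma> \<Longrightarrow> \<rho>\<^sub>1 g = psl (F g)"
    and F': "\<And>g. g \<in> carrier \<Gamma> \<Longrightarrow> \<rho>\<^sub>2 g = psl (F' g)"
    using assms(2,5) by metis
  have hom: "(\<lambda>g. psl (F g)) \<in> hom \<Gamma> PSL2R" "(\<lambda>g. psl (F' g)) \<in> hom \<Gamma> PSL2R"
    using assms(2,5) F F' by (auto simp: hom_def Pi_iff simp del: psl_mult)
  have tr: "(trace (F g))\<^sup>2 = (trace (F' g))\<^sup>2" if "g \<in> \<Delta>" for g
    using assms(10) that F F' by (metis \<Delta>.mem_carrier tr2_psl)
  note pair = finite_index_pair[OF assms(1,2,4,8,9)]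
  \<comment> \<open>Conjugating by the unit adds no condition, so this is just a non-degenerate pair
    in the image of \<open>\<Delta>\<close>.\<close>
  obtain a b A B where ab: "a \<in> \<Delta>" "b \<in> \<Delta>" and ab_psl: "\<rho>\<^sub>1 a = psl A" "\<rho>\<^sub>1 b = psl B"
    and AB: "det A = 1" "det B = 1" "trace A > 2" "trace B \<noteq> 0" "trace (A ** B) \<noteq> 0"
      "det (A ** B - B ** A) \<noteq> 0"
    by (rule pair[OF \<Gamma>.one_closed])
  have abF: "psl A = psl (F a)" "psl B = psl (F b)" using ab ab_psl F by auto
  obtain A' where A': "psl A' = psl (F' a)" "trace A' = trace A"
    using psl_lift_trace[of A "F' a"] tr[OF ab(1)] trace_square_cong[OF abF(1)] by metis
  obtain B' where B': "psl B' = psl (F' b)" "trace B' = trace B"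
    using psl_lift_trace[of B "F' b"] tr[OF ab(2)] trace_square_cong[OF abF(2)] by metis
  have det': "det A' = 1" "det B' = 1"
    using A' B' hom_in_carrier[OF hom(2)] ab by (metis \<Delta>.mem_carrier psl_det)+
  \<comment> \<open>Once the signs of \<open>A'\<close> and \<open>B'\<close> are chosen to match
    traces, the trace of the product agrees exactly and not merely up to sign.\<close>
  have "trace (A ** B) = trace (A' ** B')"
    by (rule trace_product_eq[OF assms(1) hom assms(8) tr ab(1) abF(1) A'(1) _ _ ab(2) abF(2) B'(1)])
      (use A' B' AB in auto)
  moreover obtain m where "m \<noteq> 0" "trace A = m + 1 / m" by (rule trace_as_sum_inverse[OF AB(3)])
  ultimately obtain T S where TS: "S ** T = mat 1" "T ** S = mat 1" "A' = T ** A ** S" "B' = T ** B ** S"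
    using pair_conjugate[OF AB(1,2) det' AB(6)] A'(2) B'(2) by metis
  \<comment> \<open>Conjugating the first representation makes \<open>A'\<close> and
    \<open>B'\<close> common lifts, so that \<open>E\<close> and \<open>F'\<close> can be compared
    directly.\<close>
  define E where "E g = T ** F g ** S" for g
  have conj_mult: "T ** (X ** Y) ** S = (T ** X ** S) ** (T ** Y ** S)" for X Y
  proof -
    have "(T ** X ** S) ** (T ** Y ** S) = T ** X ** (S ** T) ** Y ** S" by (simp add: matrix_mul_assoc)
    then show ?thesis by (simp add: TS matrix_mul_assoc)
  qed
  have "det S * det T = 1" using TS(1) by (metis det_I det_mul)
  then have conj_det: "det (T ** X ** S) = det X" for X by (simp add: det_mul algebra_simps)
  have conj_tr: "trace (T ** X ** S) = trace X" for X by (rule trace_conj[OF TS(1)])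
  have E: "(\<lambda>g. psl (E g)) \<in> hom \<Gamma> PSL2R"
  proof (rule homI)
    fix g assume "g \<in> carrier \<Gamma>"
    then have "det (E g) = 1"
      using psl_det hom_in_carrier[OF hom(1)] unfolding E_def conj_det by blast
    then show "psl (E g) \<in> carrier PSL2R" by (simp add: carrier_PSL2R)
  next
    fix g h assume gh: "g \<in> carrier \<Gamma>" "h \<in> carrier \<Gamma>"
    have "psl (F (g \<otimes>\<^bsub>\<Gamma>\<^esub> h)) = psl (F g ** F h)" using hom_mult[OF hom(1) gh] by simp
    then have "psl (E (g \<otimes>\<^bsub>\<Gamma>\<^esub> h)) = psl (T ** (F g ** F h) ** S)"
      unfolding E_def by (rule psl_conj_cong)
    then show "psl (E (g \<otimes>\<^bsub>\<Gamma>\<^esub> h)) = psl (E g) \<otimes>\<^bsub>PSL2R\<^esub> psl (E h)"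
      by (simp add: E_def conj_mult)
  qed
  have trE: "(trace (E g))\<^sup>2 = (trace (F' g))\<^sup>2" if "g \<in> \<Delta>" for g
    using tr[OF that] by (simp add: E_def conj_tr)
  \<comment> \<open>The commutator determinant is a function of traces, which conjugation
    preserves.\<close>
  have nondeg: "det ((T ** X ** S) ** (T ** Y ** S) - (T ** Y ** S) ** (T ** X ** S)) \<noteq> 0"
    if "det (X ** Y - Y ** X) \<noteq> 0" "det X = 1" "det Y = 1" for X Y
  proof -
    have "det ((T ** X ** S) ** (T ** Y ** S) - (T ** Y ** S) ** (T ** X ** S)) = det (X ** Y - Y ** X)"
      using det_commutator[of X Y] det_commutator[of "T ** X ** S" "T ** Y ** S"] that(2,3)
      by (simp only: conj_det conj_tr conj_mult[symmetric])
    then show ?thesis using that(1) by simp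
  qed
  have eq\<Delta>: "psl (E g) = psl (F' g)" if "g \<in> \<Delta>" for g
  proof (rule rigid_on_subgroup[OF assms(1) E hom(2) assms(8) trE ab(1) _ A'(1) _ ab(2) _ B'(1)])
    show "psl A' = psl (E a)" "psl B' = psl (E b)"
      unfolding TS E_def by (rule psl_conj_cong[OF abF(1)], rule psl_conj_cong[OF abF(2)])
    show "det (A' ** B' - B' ** A') \<noteq> 0" unfolding TS using nondeg AB by blast
    show "trace (A' ** B') \<noteq> 0" using AB by (simp add: TS conj_tr flip: conj_mult)
  qed (use A' B' AB that in auto)
  have eq: "psl (E g) = psl (F' g)" if g: "g \<in> carrier \<Gamma>" for g
  proof -
    \<comment> \<open>Each \<open>g\<close> needs a new pair, since the conjugates of
      \<open>a\<close> and \<open>b\<close> by \<open>g\<close> may leave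
      \<open>\<Delta>\<close>.\<close>
    obtain c d C D where cd: "c \<in> \<Delta>" "d \<in> \<Delta>" "g \<otimes>\<^bsub>\<Gamma>\<^esub> c \<otimes>\<^bsub>\<Gamma>\<^esub> inv\<^bsub>\<Gamma>\<^esub> g \<in> \<Delta>"
      "g \<otimes>\<^bsub>\<Gamma>\<^esub> d \<otimes>\<^bsub>\<Gamma>\<^esub> inv\<^bsub>\<Gamma>\<^esub> g \<in> \<Delta>" "\<rho>\<^sub>1 c = psl C" "\<rho>\<^sub>1 d = psl D" "det C = 1" "det D = 1"
      "trace C > 2" "trace D \<noteq> 0" "trace (C ** D) \<noteq> 0" "det (C ** D - D ** C) \<noteq> 0"
      by (rule pair[OF g])
    have psl: "psl (T ** C ** S) = psl (E c)" "psl (T ** D ** S) = psl (E d)"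
      unfolding E_def by (intro psl_conj_cong; use cd F in simp)+
    have tr: "trace (T ** C ** S) \<noteq> 0" "trace (T ** D ** S) \<noteq> 0" using cd by (auto simp: conj_tr)
    show ?thesis
      by (rule rigid_on_group[OF assms(1) E hom(2) assms(8) trE eq\<Delta> g cd(1,3) psl(1) tr(1)
            cd(2,4) psl(2) tr(2) nondeg[OF cd(12,7,8)]])
  qed
  have invT: "inv\<^bsub>PGL2R\<^esub> (pgl T) = pgl S" by (rule pgl_inv[OF TS(2,1)])
  show ?thesis
  proof (rule ex1I[of _ "pgl T"], intro conjI ballI)
    show "pgl T \<in> carrier PGL2R" using TS by (auto simp: carrier_PGL2R invertible_def)
    fix g assume g: "g \<in> carrier \<Gamma>"
    have "PSL_to_PGL (\<rho>\<^sub>2 g) = PSL_to_PGL (psl (E g))" using F'[OF g] eq[OF g] by simp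
    then show "PSL_to_PGL (\<rho>\<^sub>2 g) =
        pgl T \<otimes>\<^bsub>PGL2R\<^esub> PSL_to_PGL (\<rho>\<^sub>1 g) \<otimes>\<^bsub>PGL2R\<^esub> inv\<^bsub>PGL2R\<^esub> (pgl T)"
      using F[OF g] by (simp add: invT E_def)
  next
    fix t assume t: "t \<in> carrier PGL2R \<and> (\<forall>g\<in>carrier \<Gamma>. PSL_to_PGL (\<rho>\<^sub>2 g) =
        t \<otimes>\<^bsub>PGL2R\<^esub> PSL_to_PGL (\<rho>\<^sub>1 g) \<otimes>\<^bsub>PGL2R\<^esub> inv\<^bsub>PGL2R\<^esub> t)"
    then obtain Q R where Q: "t = pgl Q" "Q ** R = mat 1" "R ** Q = mat 1"
      by (auto simp: carrier_PGL2R invertible_def)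
    \<comment> \<open>\<open>H\<close> measures the difference of the two conjugators
      \<open>T\<close> and \<open>Q\<close>; uniqueness amounts to showing that it is
      scalar.\<close>
    define H where "H = S ** Q"
    have inv: "invertible H"
      using TS Q unfolding H_def invertible_def by (metis matrix_mul_assoc matrix_mul_lid)
    have commute: "H ** X = X ** H" if x: "x \<in> \<Delta>" "psl X = psl (F x)" "trace X \<noteq> 0" for x X
    proof -
      have car: "x \<in> carrier \<Gamma>" using x by simp
      have "pgl (T ** X ** S) = pgl (Q ** X ** R)"
      proof -
        have "pgl (Q ** X ** R) = PSL_to_PGL (\<rho>\<^sub>2 x)"
          using t car F[OF car] x Q pgl_inv[OF Q(2,3)] PSL_to_PGL_psl pgl_mult by metis
        also have "\<dots> = PSL_to_PGL (psl (T ** X ** S))"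
          using F'[OF car] eq[OF car] psl_conj_cong[OF x(2)] by (simp add: E_def del: PSL_to_PGL_psl)
        finally show ?thesis by simp
      qed
      \<comment> \<open>Equality in \<open>PGL2R\<close> identifies the two conjugates of
        \<open>X\<close> only up to a factor, which the non-zero trace then shows to be
        \<open>1\<close>.\<close>
      then obtain c where c: "Q ** X ** R = c *\<^sub>R (T ** X ** S)" by (metis pgl_eqD)
      have "H ** X = S ** (Q ** X ** R) ** Q"
        using Q by (simp add: H_def flip: matrix_mul_assoc)
      also have "\<dots> = c *\<^sub>R ((S ** T) ** X ** (S ** Q))" unfolding c by (simp add: matrix_mul_assoc)
      finally have "H ** X = c *\<^sub>R (X ** H)" by (simp add: TS H_def)
      then show ?thesis using scaled_commute[OF inv _ x(3)] by blast
    qed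
    have "H = (H$1$1) *\<^sub>R mat 1"
      using centralizer_scalar[OF AB(6)] commute[OF ab(1) abF(1)] commute[OF ab(2) abF(2)] AB by simp
    then obtain c where c: "H = c *\<^sub>R mat 1" by blast
    have "c \<noteq> 0" using inv c by (auto simp: invertible_det_nz det_2)
    moreover have "Q = T ** H" by (simp add: H_def matrix_mul_assoc TS)
    ultimately show "t = pgl T" using c Q(1) pgl_scale by simp
  qed
qed

end
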